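(* Let $\mathfrak c=2^{\aleph_0}$. Each of the following groups has precisely $2^{\mathfrak c}$ maximal subgroups: (1) $\operatorname{Sym}(\mathbb N)=\operatorname{Homeo}(\mathbb N)$, where $\mathbb N$ is discrete; (2) $\operatorname{Homeo}(\mathbb Q)$; (3) $\operatorname{Homeo}(\mathbb N^{\mathbb N})$; (4) $\operatorname{Homeo}(\mathbb N\times 2^{\mathbb N})$; (5) $\operatorname{Homeo}(\omega^2)$, where the ordinal $\omega^2$ carries the usual order topology; (6) $\operatorname{Homeo}(\mathbb S)$, where $\mathbb S$ denotes the Sorgenfrey line.
   Context: A proper subgroup $M$ of a group $G$ is maximal if there is no subgroup $H$ of $G$ with $M<H<G$. $\operatorname{Homeo}(X)$ is the group of all homeomorphisms of the space $X$. $\mathbb Q$ has its usual topology as a subspace of $\mathbb R$; $\mathbb N^{\mathbb N}$ is the Baire space (product topology, $\mathbb N$ discrete); $2^{\mathbb N}$ is the Cantor space; $\mathbb N\times 2^{\mathbb N}$ has the product topology with $\mathbb N$ discrete. The Sorgenfrey line $\mathbb S$ is $\mathbb R$ with the topology whose basis consists of the half-open intervals $[a,b)$, $a<b$. *)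

theory Defs
  imports "HOL-Analysis.Analysis" "HOL-Algebra.Bij"
begin

definition maximal_subgroup :: "'a set \<Rightarrow> ('a, 'b) monoid_scheme \<Rightarrow> bool" where
  "maximal_subgroup M G \<longleftrightarrow>
     subgroup M G \<and> M \<noteq> carrier G \<and>
     \<not> (\<exists>H. subgroup H G \<and> M \<subset> H \<and> H \<subset> carrier G)"

text \<open>As in \<^const>\<open>BijGroup\<close>, self-maps of the space are represented by functions that are
  extensional on \<^term>\<open>topspace X\<close>, so that each homeomorphism is counted exactly once.\<close>

definition homeo_group :: "'a topology \<Rightarrow> ('a \<Rightarrow> 'a) monoid" where
  "homeo_group X = BijGroup (topspace X)
     \<lparr>carrier := {f \<in> extensional (topspace X). homeomorphic_map X X f}\<rparr>"

lemma subgroup_homeo_group: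
  "subgroup {f \<in> extensional (topspace X). homeomorphic_map X X f} (BijGroup (topspace X))"
  (is "subgroup ?H ?B")
proof
  have bij: "f \<in> Bij (topspace X)" if "f \<in> ?H" for f
    using that by (auto simp: Bij_def bij_betw_def homeomorphic_eq_everything_map)
  then show "?H \<subseteq> carrier ?B"
    by (auto simp: BijGroup_def)
  show "f \<otimes>\<^bsub>?B\<^esub> g \<in> ?H" if f: "f \<in> ?H" and g: "g \<in> ?H" for f g
  proof -
    have "homeomorphic_map X X (compose (topspace X) f g)"
      by (rule homeomorphic_map_eq[OF homeomorphic_map_compose[of X X g X f]])
        (use f g in \<open>auto simp: compose_def\<close>)
    then show ?thesis
      using bij[OF f] bij[OF g] by (simp add: BijGroup_def)
  qed
  show "\<one>\<^bsub>?B\<^esub> \<in> ?H"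
    using homeomorphic_map_eq[OF homeomorphic_map_id[THEN iffD2, OF refl], of X "\<lambda>x\<in>topspace X. x"]
    by (simp add: BijGroup_def)
  show "inv\<^bsub>?B\<^esub> f \<in> ?H" if f: "f \<in> ?H" for f
  proof -
    obtain g where g: "homeomorphic_maps X X f g"
      using f homeomorphic_map_maps by blast
    then have gX: "g x \<in> topspace X" "f (g x) = x" if "x \<in> topspace X" for x
      using that by (auto simp: homeomorphic_maps_def continuous_map_def)
    have "g x = restrict (inv_into (topspace X) f) (topspace X) x" if "x \<in> topspace X" for x
      using gX[OF that] that bij[OF f]
      by (simp add: Bij_def bij_betw_def) (metis inv_into_f_f)
    moreover have "homeomorphic_map X X g"
      using g homeomorphic_maps_map by blast
    ultimately have "homeomorphic_map X X (restrict (inv_into (topspace X) f) (topspace X))"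
      using homeomorphic_map_eq by blast
    then show ?thesis
      using inv_BijGroup[OF bij[OF f]] by simp
  qed
qed

lemma group_homeo_group: "group (homeo_group X)"
  unfolding homeo_group_def
  by (rule subgroup.subgroup_is_group[OF subgroup_homeo_group group_BijGroup])

text \<open>The order topology of the strict linear order \<open>r\<close> on all of \<^typ>\<open>'a\<close>. The whole
  space is added to the subbase of open rays to cover one-point orders.\<close>

definition order_topology_of :: "('a \<times> 'a) set \<Rightarrow> 'a topology" where
  "order_topology_of r = topology_generated_by
     (insert UNIV (range (\<lambda>a. {x. (x, a) \<in> r}) \<union> range (\<lambda>a. {x. (a, x) \<in> r})))"

text \<open>The ordinal \<open>\<omega>\<^sup>2 = \<omega> \<cdot> \<omega>\<close> is realized as \<^typ>\<open>nat \<times> nat\<close>, where \<open>(m, n)\<close> stands for the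
  ordinal \<open>\<omega> \<cdot> m + n\<close>; the order on these ordinals is the lexicographic one.\<close>

definition omega_squared :: "(nat \<times> nat) topology" where
  "omega_squared = order_topology_of (less_than <*lex*> less_than)"

definition sorgenfrey_line :: "real topology" where
  "sorgenfrey_line = topology_generated_by {{a..<b} | a b. a < b}"

lemma openin_sorgenfrey_line:
  "openin sorgenfrey_line U \<longleftrightarrow> (\<forall>x\<in>U. \<exists>a b. x \<in> {a..<b} \<and> {a..<b} \<subseteq> U)"
proof
  let ?B = "{{a..<b} | a b :: real. a < b}"
  assume "openin sorgenfrey_line U"
  then have "generate_topology_on ?B U"
    unfolding sorgenfrey_line_def by (rule openin_topology_generated_by)
  then show "\<forall>x\<in>U. \<exists>a b. x \<in> {a..<b} \<and> {a..<b} \<subseteq> U"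
  proof induction
    case (Int U V)
    show ?case
    proof
      fix x assume "x \<in> U \<inter> V"
      then obtain a b c d where "x \<in> {a..<b}" "{a..<b} \<subseteq> U" "x \<in> {c..<d}" "{c..<d} \<subseteq> V"
        using Int.IH by (meson IntE)
      then have "x \<in> {max a c..<min b d} \<and> {max a c..<min b d} \<subseteq> U \<inter> V"
        by auto
      then show "\<exists>a b. x \<in> {a..<b} \<and> {a..<b} \<subseteq> U \<inter> V"
        by blast
    qed
  next
    case (UN K)
    then show ?case by (meson Union_iff Union_upper subset_trans)
  next
    case (Basis s)
    then show ?case by blast
  qed simp
next
  assume *: "\<forall>x\<in>U. \<exists>a b. x \<in> {a..<b} \<and> {a..<b} \<subseteq> U"
  show "openin sorgenfrey_line U"
  proof (subst openin_subopen, safe)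
    fix x assume "x \<in> U"
    then obtain a b where ab: "x \<in> {a..<b}" "{a..<b} \<subseteq> U"
      using * by blast
    then have "openin sorgenfrey_line {a..<b}"
      unfolding sorgenfrey_line_def by (intro topology_generated_by_Basis) force
    with ab show "\<exists>T. openin sorgenfrey_line T \<and> x \<in> T \<and> T \<subseteq> U"
      by blast
  qed
qed

abbreviation baire_space :: "(nat \<Rightarrow> nat) topology" where
  "baire_space \<equiv> product_topology (\<lambda>_. discrete_topology UNIV) UNIV"

abbreviation cantor_space :: "(nat \<Rightarrow> bool) topology" where
  "cantor_space \<equiv> product_topology (\<lambda>_. discrete_topology UNIV) UNIV"

text \<open>With \<open>\<cc> = 2\<^sup>\<aleph>\<^sup>0\<close> being the cardinality of \<^term>\<open>UNIV :: nat set set\<close>, the cardinal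
  \<open>2\<^sup>\<cc>\<close> is that of its power set.\<close>

definition has_two_to_continuum_maximal_subgroups :: "('a, 'b) monoid_scheme \<Rightarrow> bool" where
  "has_two_to_continuum_maximal_subgroups G \<longleftrightarrow>
     {M. maximal_subgroup M G} \<approx> Pow (UNIV :: nat set set)"

end

(*
  Each of the six spaces is a disjoint union of countably many nonempty, pairwise homeomorphic
  open pieces. An Eilenberg-Mazur swindle then shows that a homeomorphism between clopen sets
  extends to the whole space as soon as the complement of each of them contains infinitely many
  pieces. Consequently, if p and q are distinct ultrafilters of clopen sets, then the stabilizer
  of p carries q to every ultrafilter other than p in the orbit of q. As that orbit is not
  contained in {p, q}, all stabilizers of ultrafilters are maximal and pairwise distinct. An independent family
  of subsets of the set of pieces provides 2^c ultrafilters. Conversely, a homeomorphism of a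
  separable Hausdorff space is determined by its values on a countable dense set, so the group
  has at most c elements and hence at most 2^c subgroups.
*)

theory Submission
  imports Defs
begin

text \<open>Stabilizers of points would be at most c many; ultrafilters of clopen sets, the points
  of the Stone space of the clopen algebra, are numerous enough for 2^c. The obstacle is that a
  homeomorphism between clopen sets need not extend: the shift from N onto N - {0} is not the
  restriction of any bijection of N. Room for the extension comes from splitting the pieces into
  three infinite classes. An ultrafilter contains exactly one class, so a map that has to be
  prescribed near two ultrafilters can be shrunk until two classes contain its domain and two
  contain its range, and each side keeps a free class. The action on all ultrafilters can fail to be
  transitive: in omega^2 no homeomorphism takes an isolated point to a limit point.\<close>

section \<open>Homeomorphisms between open sets, and their gluing\<close>

text \<open>For open \<open>U\<close>, the set \<open>V\<close> is open too and \<open>f\<close> is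
  a homeomorphism of the two subspaces. Testing openness in \<open>X\<close> itself avoids a change
  of topology whenever a map is restricted or glued.\<close>

definition homeo_between :: "'a topology \<Rightarrow> ('a \<Rightarrow> 'a) \<Rightarrow> 'a set \<Rightarrow> 'a set \<Rightarrow> bool" where
  "homeo_between X f U V \<longleftrightarrow>
     bij_betw f U V \<and> (\<forall>W\<subseteq>U. openin X (f ` W) \<longleftrightarrow> openin X W)"

lemma homeo_between_imageD: "homeo_between X f U V \<Longrightarrow> f ` U = V"
  by (simp add: homeo_between_def bij_betw_def)

lemma homeo_between_openD:
  "homeo_between X f U V \<Longrightarrow> W \<subseteq> U \<Longrightarrow> openin X (f ` W) \<longleftrightarrow> openin X W"
  by (simp add: homeo_between_def)

lemma homeo_between_id: "homeo_between X id U U"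
  by (simp add: homeo_between_def)

lemma homeo_between_cong:
  "(\<And>x. x \<in> U \<Longrightarrow> f x = g x) \<Longrightarrow> homeo_between X f U V \<longleftrightarrow> homeo_between X g U V"
proof -
  assume eq: "\<And>x. x \<in> U \<Longrightarrow> f x = g x"
  then have "bij_betw f U V \<longleftrightarrow> bij_betw g U V"
    by (rule bij_betw_cong)
  moreover have "f ` W = g ` W" if "W \<subseteq> U" for W
    using eq that by (intro image_cong) auto
  ultimately show ?thesis
    by (simp add: homeo_between_def)
qed

lemma homeo_between_comp:
  assumes "homeo_between X f U V" and "homeo_between X g V W"
  shows "homeo_between X (g \<circ> f) U W"
proof -
  have "openin X ((g \<circ> f) ` S) \<longleftrightarrow> openin X S" if "S \<subseteq> U" for S
  proof -
    have "f ` S \<subseteq> V"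
      using image_mono[OF that, of f] homeo_between_imageD[OF assms(1)] by simp
    then show ?thesis
      using homeo_between_openD[OF assms(1) that] homeo_between_openD[OF assms(2)]
      by (metis image_comp)
  qed
  moreover have "bij_betw (g \<circ> f) U W"
    using assms bij_betw_trans unfolding homeo_between_def by blast
  ultimately show ?thesis
    by (simp add: homeo_between_def)
qed

lemma homeo_between_inv_into:
  assumes "homeo_between X f U V"
  shows "homeo_between X (inv_into U f) V U"
proof -
  have bij: "bij_betw f U V"
    using assms by (simp add: homeo_between_def)
  have "openin X (inv_into U f ` W) \<longleftrightarrow> openin X W" if "W \<subseteq> V" for W
  proof -
    have "f ` inv_into U f ` W = W" "inv_into U f ` W \<subseteq> U"
      using that image_inv_into_cancel[of f U V W] bij_betw_imp_surj_on[OF bij]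
        image_mono[OF that, of "inv_into U f"] bij_betw_imp_surj_on[OF bij_betw_inv_into[OF bij]]
      by simp_all
    then show ?thesis
      using homeo_between_openD[OF assms, of "inv_into U f ` W"] by simp
  qed
  then show ?thesis
    using bij by (simp add: homeo_between_def bij_betw_inv_into)
qed

lemma homeo_between_subset:
  assumes "homeo_between X f U V" and "A \<subseteq> U"
  shows "homeo_between X f A (f ` A)"
proof -
  have "bij_betw f A (f ` A)"
    using assms by (auto simp: homeo_between_def bij_betw_def intro: inj_on_subset)
  then show ?thesis
    using homeo_between_openD[OF assms(1)] assms(2) by (auto simp: homeo_between_def)
qed

text \<open>A subset of a union of open pieces is open as soon as its trace on every piece is. This
  applies on both sides, the \<open>B i\<close> being open as images of the open \<open>A i\<close>,
  so \<open>W\<close> and its image can be compared piece by piece.\<close>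

lemma homeo_between_glue:
  assumes hom: "\<And>i. i \<in> I \<Longrightarrow> homeo_between X (f i) (A i) (B i)"
    and opA: "\<And>i. i \<in> I \<Longrightarrow> openin X (A i)"
    and disjA: "disjoint_family_on A I" and disjB: "disjoint_family_on B I"
  shows "\<exists>F. homeo_between X F (\<Union>i\<in>I. A i) (\<Union>i\<in>I. B i) \<and> (\<forall>i\<in>I. \<forall>x\<in>A i. F x = f i x)"
proof (intro exI conjI ballI)
  define F where "F x = f (THE i. i \<in> I \<and> x \<in> A i) x" for x
  show eq: "F x = f i x" if "i \<in> I" "x \<in> A i" for i x
  proof -
    have "(THE i. i \<in> I \<and> x \<in> A i) = i"
      using that disjA by (intro the_equality) (auto simp: disjoint_family_on_def)
    then show ?thesis by (simp add: F_def)
  qed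
  have homF: "homeo_between X F (A i) (B i)" if "i \<in> I" for i
    using hom[OF that] homeo_between_cong[of "A i" F "f i" X "B i"] eq[OF that] by simp
  have opB: "openin X (B i)" if "i \<in> I" for i
    using homeo_between_openD[OF homF[OF that], of "A i"] homeo_between_imageD[OF homF[OF that]]
      opA[OF that] by simp
  have bij: "bij_betw F (\<Union>i\<in>I. A i) (\<Union>i\<in>I. B i)"
    using homF by (intro bij_betw_UNION_disjoint disjB) (auto simp: homeo_between_def)
  have "openin X (F ` W) \<longleftrightarrow> openin X W" if W: "W \<subseteq> (\<Union>i\<in>I. A i)" for W
  proof -
    have img: "F ` W \<inter> B i = F ` (W \<inter> A i)" if "i \<in> I" for i
    proof -
      have "F ` W \<inter> F ` A i = F ` (W \<inter> A i)"
        using bij W that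
        by (intro inj_on_image_Int[symmetric, of F "\<Union>i\<in>I. A i"]) (auto simp: bij_betw_def)
      then show ?thesis
        using homeo_between_imageD[OF homF[OF that]] by simp
    qed
    have "openin X W \<longleftrightarrow> (\<forall>i\<in>I. openin X (W \<inter> A i))"
    proof
      assume "\<forall>i\<in>I. openin X (W \<inter> A i)"
      then have "openin X (\<Union>i\<in>I. W \<inter> A i)" by (intro openin_Union) auto
      then show "openin X W" using W by (simp only: Int_UN_distrib[symmetric] Int_absorb2)
    qed (simp add: opA openin_Int)
    also have "\<dots> \<longleftrightarrow> (\<forall>i\<in>I. openin X (F ` W \<inter> B i))"
      using homeo_between_openD[OF homF] img by simp
    also have "\<dots> \<longleftrightarrow> openin X (F ` W)"
    proof
      assume "\<forall>i\<in>I. openin X (F ` W \<inter> B i)"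
      then have "openin X (\<Union>i\<in>I. F ` W \<inter> B i)" by (intro openin_Union) auto
      moreover have "F ` W \<subseteq> (\<Union>i\<in>I. B i)" using image_mono[OF W, of F] bij_betw_imp_surj_on[OF bij] by simp
      ultimately show "openin X (F ` W)" by (simp only: Int_UN_distrib[symmetric] Int_absorb2)
    qed (simp add: opB openin_Int)
    finally show ?thesis ..
  qed
  with bij show "homeo_between X F (\<Union>i\<in>I. A i) (\<Union>i\<in>I. B i)"
    by (simp add: homeo_between_def)
qed

lemma homeo_between_glue2:
  assumes f: "homeo_between X f A A'" and g: "homeo_between X g B B'"
    and op: "openin X A" "openin X B" and disj: "A \<inter> B = {}" "A' \<inter> B' = {}"
  shows "\<exists>F. homeo_between X F (A \<union> B) (A' \<union> B') \<and> (\<forall>x\<in>A. F x = f x) \<and> (\<forall>x\<in>B. F x = g x)"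
proof -
  define h where "h i = (if i then f else g)" for i
  define P where "P i = (if i then A else B)" for i
  define Q where "Q i = (if i then A' else B')" for i
  have hom: "homeo_between X (h i) (P i) (Q i)" and "openin X (P i)" for i
    using f g op by (simp_all add: h_def P_def Q_def)
  moreover have "disjoint_family P" "disjoint_family Q"
    using disj by (auto simp: disjoint_family_on_def P_def Q_def)
  ultimately have "\<exists>F. homeo_between X F (\<Union>i. P i) (\<Union>i. Q i) \<and> (\<forall>i\<in>UNIV. \<forall>x\<in>P i. F x = h i x)"
    by (intro homeo_between_glue)
  then obtain F where F: "homeo_between X F (\<Union>i. P i) (\<Union>i. Q i)"
    and eq: "\<And>i x. x \<in> P i \<Longrightarrow> F x = h i x"
    by blast
  have "(\<Union>i. P i) = A \<union> B" "(\<Union>i. Q i) = A' \<union> B'"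
    by (auto simp: P_def Q_def UNIV_bool)
  with F have "homeo_between X F (A \<union> B) (A' \<union> B')" by simp
  moreover have "F x = f x" if "x \<in> A" for x
    using eq[of x True] that by (simp add: h_def P_def)
  moreover have "F x = g x" if "x \<in> B" for x
    using eq[of x False] that by (simp add: h_def P_def)
  ultimately show ?thesis by blast
qed

definition homeo_equiv :: "'a topology \<Rightarrow> 'a set \<Rightarrow> 'a set \<Rightarrow> bool" where
  "homeo_equiv X U V \<longleftrightarrow> (\<exists>f. homeo_between X f U V)"

lemma homeo_equiv_refl: "homeo_equiv X U U"
  using homeo_between_id homeo_equiv_def by blast

lemma homeo_equiv_sym: "homeo_equiv X U V \<Longrightarrow> homeo_equiv X V U"
  unfolding homeo_equiv_def using homeo_between_inv_into by blast

lemma homeo_equiv_trans [trans]: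
  "homeo_equiv X U V \<Longrightarrow> homeo_equiv X V W \<Longrightarrow> homeo_equiv X U W"
  unfolding homeo_equiv_def using homeo_between_comp by blast

lemma homeo_equiv_UN:
  assumes "\<And>i. i \<in> I \<Longrightarrow> homeo_equiv X (A i) (B i)" "\<And>i. i \<in> I \<Longrightarrow> openin X (A i)"
    and "disjoint_family_on A I" "disjoint_family_on B I"
  shows "homeo_equiv X (\<Union>i\<in>I. A i) (\<Union>i\<in>I. B i)"
proof -
  obtain f where "\<And>i. i \<in> I \<Longrightarrow> homeo_between X (f i) (A i) (B i)"
    using assms(1) unfolding homeo_equiv_def by metis
  then show ?thesis
    using homeo_between_glue[of I X f A B] assms(2-) unfolding homeo_equiv_def by meson
qed

lemma homeo_equiv_Un:
  assumes "homeo_equiv X A A'" "homeo_equiv X B B'" "openin X A" "openin X B"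
    and "A \<inter> B = {}" "A' \<inter> B' = {}"
  shows "homeo_equiv X (A \<union> B) (A' \<union> B')"
proof -
  obtain f g where "homeo_between X f A A'" "homeo_between X g B B'"
    using assms(1,2) unfolding homeo_equiv_def by blast
  from homeo_between_glue2[OF this assms(3-)] show ?thesis
    unfolding homeo_equiv_def by blast
qed

section \<open>Clopen sets; spaces made of infinitely many copies of one piece\<close>

definition clopenin :: "'a topology \<Rightarrow> 'a set \<Rightarrow> bool" where
  "clopenin X A \<longleftrightarrow> openin X A \<and> openin X (topspace X - A)"

lemma clopenin_subset: "clopenin X A \<Longrightarrow> A \<subseteq> topspace X"
  by (simp add: clopenin_def openin_subset)

lemma clopenin_openin: "clopenin X A \<Longrightarrow> openin X A"
  by (simp add: clopenin_def)

lemma clopenin_topspace: "clopenin X (topspace X)"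
  by (simp add: clopenin_def)

lemma clopenin_Diff_topspace: "clopenin X A \<Longrightarrow> clopenin X (topspace X - A)"
  by (simp add: clopenin_def double_diff openin_subset)

lemma clopenin_Int: "clopenin X A \<Longrightarrow> clopenin X B \<Longrightarrow> clopenin X (A \<inter> B)"
  by (simp add: clopenin_def Diff_Int openin_Un openin_Int)

lemma clopenin_Diff:
  assumes "clopenin X A" "clopenin X B" shows "clopenin X (A - B)"
proof -
  have "A - B = A \<inter> (topspace X - B)"
    using clopenin_subset[OF assms(1)] by blast
  then show ?thesis
    using assms by (simp add: clopenin_Int clopenin_Diff_topspace)
qed

lemma clopenin_Un:
  assumes "clopenin X A" "clopenin X B" shows "clopenin X (A \<union> B)"
  using assms by (simp add: clopenin_def Diff_Un openin_Un openin_Int)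

text \<open>\<open>c\<close> names the piece that contains a point, so the pieces are disjoint and
  cover the space by construction. Openness of all fibres makes every union of pieces
  clopen.\<close>

locale infinitely_self_similar =
  fixes X :: "'a topology" and c :: "'a \<Rightarrow> nat"
  assumes open_fibre: "\<And>n. openin X {x \<in> topspace X. c x = n}"
    and fibre_nonempty: "\<And>n. \<exists>x\<in>topspace X. c x = n"
    and fibre_equiv: "\<And>n. homeo_equiv X {x \<in> topspace X. c x = 0} {x \<in> topspace X. c x = n}"
begin

definition part :: "nat set \<Rightarrow> 'a set" where
  "part I = {x \<in> topspace X. c x \<in> I}"

lemma part_UNIV: "part UNIV = topspace X"
  by (simp add: part_def)

lemma part_disjoint: "I \<inter> J = {} \<Longrightarrow> part I \<inter> part J = {}"
  by (auto simp: part_def)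

lemma openin_part: "openin X (part I)"
proof -
  have "part I = (\<Union>n\<in>I. {x \<in> topspace X. c x = n})"
    by (auto simp: part_def)
  then show ?thesis
    using open_fibre by auto
qed

lemma part_Diff: "topspace X - part I = part (- I)"
  by (auto simp: part_def)

lemma clopenin_part: "clopenin X (part I)"
  by (simp add: clopenin_def openin_part part_Diff)

text \<open>A bijection between the index sets matches the pieces. The case \<open>J = UNIV\<close>
  makes any infinite union of pieces a copy of the whole space, which is what feeds the
  swindle.\<close>

lemma homeo_equiv_part:
  assumes "infinite I" "infinite J"
  shows "homeo_equiv X (part I) (part J)"
proof -
  obtain s where s: "bij_betw s I J"
    by (metis assms bij_enumerate bij_betw_inv_into bij_betw_trans)
  have "homeo_equiv X (\<Union>n\<in>I. part {n}) (\<Union>n\<in>I. part {s n})"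
  proof (rule homeo_equiv_UN)
    show "homeo_equiv X (part {n}) (part {s n})" for n
      using homeo_equiv_trans[OF homeo_equiv_sym[OF fibre_equiv] fibre_equiv]
      by (simp add: part_def)
    show "disjoint_family_on (\<lambda>n. part {s n}) I"
      using s by (auto simp: disjoint_family_on_def part_def bij_betw_def inj_on_def)
    show "openin X (part {n})" for n
      by (rule openin_part)
  qed (auto simp: disjoint_family_on_def part_def)
  also have "(\<Union>n\<in>I. part {n}) = part I"
    by (auto simp: part_def)
  also have "(\<Union>n\<in>I. part {s n}) = part J"
    using s by (auto simp: part_def bij_betw_def)
  finally show ?thesis .
qed

text \<open>The Eilenberg--Mazur swindle
  \<open>C + (C + D) + (C + D) + \<dots> = (C + D) + (C + D) + \<dots>\<close> with \<open>C + D = X\<close>.\<close>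

lemma homeo_equiv_absorb:
  assumes C: "clopenin X C" and J: "infinite J" and disj: "C \<inter> part J = {}"
  shows "homeo_equiv X (C \<union> part J) (topspace X)"
proof -
  obtain s where s: "bij_betw s (UNIV :: nat set) J"
    using J bij_enumerate by blast
  \<comment> \<open>The rows of the pairing function split \<open>J\<close> into infinitely many
    infinite sets. Each \<open>part (K k)\<close> is a copy of the space and so falls into a copy of
    \<open>C\<close> and a copy of \<open>D\<close>.\<close>
  define K where "K k = s ` range (\<lambda>n. prod_encode (k, n))" for k
  have s_inj: "inj s" and s_range: "range s = J"
    using s by (auto simp: bij_betw_def)
  have K_inf: "infinite (K k)" for k
  proof -
    have "inj (\<lambda>n. s (prod_encode (k, n)))"
      by (simp add: inj_def inj_eq[OF s_inj])
    then show ?thesis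
      unfolding K_def image_image by (rule range_inj_infinite)
  qed
  have K_disj: "K k \<inter> K l = {}" if "k \<noteq> l" for k l
    using that by (auto simp: K_def inj_eq[OF s_inj])
  have K_UN: "(\<Union>k. K k) = J"
  proof
    show "J \<subseteq> (\<Union>k. K k)"
    proof
      fix j assume "j \<in> J"
      then obtain m where "j = s m" using s_range by blast
      then have "j = s (prod_encode (fst (prod_decode m), snd (prod_decode m)))" by simp
      then show "j \<in> (\<Union>k. K k)" unfolding K_def by blast
    qed
  qed (use s_range in \<open>auto simp: K_def\<close>)
  have part_K_disj: "part (K k) \<inter> part (K l) = {}" if "k \<noteq> l" for k l
    by (intro part_disjoint K_disj that)
  have part_K_UN: "(\<Union>k. part (K k)) = part J"
    using K_UN by (auto simp: part_def)
  have "\<exists>f. homeo_between X f (topspace X) (part (K k))" for k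
    using homeo_equiv_part[of UNIV "K k"] K_inf by (simp add: part_UNIV homeo_equiv_def)
  then obtain f where f: "\<And>k. homeo_between X (f k) (topspace X) (part (K k))"
    by metis
  define D where "D = topspace X - C"
  have CD: "C \<inter> D = {}" "C \<union> D = topspace X" "openin X C" "openin X D"
    using C clopenin_subset[OF C] by (auto simp: D_def clopenin_def)
  have fC: "homeo_between X (f k) C (f k ` C)" and fD: "homeo_between X (f k) D (f k ` D)" for k
    using homeo_between_subset[OF f, of C k] homeo_between_subset[OF f, of D k] CD(2) by auto
  have f_Un: "f k ` C \<union> f k ` D = part (K k)" for k
    using homeo_between_imageD[OF f] CD(2) by (simp flip: image_Un)
  then have f_sub: "f k ` C \<subseteq> part (K k)" "f k ` D \<subseteq> part (K k)" for k
    by (metis Un_upper1, metis Un_upper2)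
  have f_Int: "f k ` C \<inter> f k ` D = {}" for k
    using f[of k] CD inj_on_image_Int[of "f k" "topspace X" C D]
    by (auto simp: homeo_between_def bij_betw_def)
  have f_open: "openin X (f k ` C)" "openin X (f k ` D)" for k
    using homeo_between_openD[OF f, of C k] homeo_between_openD[OF f, of D k] CD by auto
  \<comment> \<open>The copies of \<open>C\<close> shifted by one place: \<open>C\<close> itself,
    then its copies in \<open>part (K 0)\<close>, \<open>part (K 1)\<close> and so on. Joining
    \<open>L k\<close> to the copy of \<open>D\<close> in \<open>part (K k)\<close> again gives a
    copy of the space, yet the new blocks cover \<open>C\<close> as well.\<close>
  define L where "L k = (case k of 0 \<Rightarrow> C | Suc l \<Rightarrow> f l ` C)" for k
  have L_equiv: "homeo_equiv X (L k) C" for k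
  proof (cases k)
    case 0
    then show ?thesis by (simp add: L_def homeo_equiv_refl)
  next
    case (Suc l)
    have "homeo_equiv X C (f l ` C)"
      using fC unfolding homeo_equiv_def by blast
    then show ?thesis by (simp add: L_def Suc homeo_equiv_sym)
  qed
  have L_open: "openin X (L k)" for k
    using f_open CD by (simp add: L_def split: nat.split)
  have L_sub: "L (Suc k) \<subseteq> part (K k)" for k
    using f_sub(1) by (simp add: L_def)
  have L_disj_D: "L k \<inter> f l ` D = {}" for k l
  proof (cases k)
    case 0
    then show ?thesis
      using f_sub(2)[of l] part_K_UN disj by (auto simp: L_def)
  next
    case (Suc m)
    have "f m ` C \<inter> f l ` D = {}"
      using f_Int[of m] part_K_disj[of m l] Int_mono[OF f_sub(1)[of m] f_sub(2)[of l]]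
      by (cases "m = l") simp_all
    then show ?thesis
      by (simp add: L_def Suc)
  qed
  have L_disj: "L k \<inter> L l = {}" if "k < l" for k l
  proof -
    obtain m where m: "l = Suc m" using \<open>k < l\<close> by (cases l) auto
    have "L l \<subseteq> part J" using m L_sub[of m] part_K_UN by blast
    show ?thesis
    proof (cases k)
      case 0
      then show ?thesis using \<open>L l \<subseteq> part J\<close> disj by (auto simp: L_def)
    next
      case (Suc n)
      then show ?thesis
        using m Int_mono[OF L_sub[of n] L_sub[of m]] part_K_disj[of n m] \<open>k < l\<close> by simp
    qed
  qed
  have "homeo_equiv X (\<Union>k. L k \<union> f k ` D) (\<Union>k. part (K k))"
  proof (rule homeo_equiv_UN)
    fix k
    have "homeo_equiv X D (f k ` D)"
      using fD unfolding homeo_equiv_def by blast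
    then have "homeo_equiv X (L k \<union> f k ` D) (C \<union> D)"
      by (intro homeo_equiv_Un L_equiv homeo_equiv_sym[of X D] L_open f_open L_disj_D CD(1))
    also have "homeo_equiv X (C \<union> D) (part (K k))"
      using f CD(2) by (auto simp: homeo_equiv_def)
    finally show "homeo_equiv X (L k \<union> f k ` D) (part (K k))" .
    show "openin X (L k \<union> f k ` D)"
      by (intro openin_Un L_open f_open)
    have "(L k \<union> f k ` D) \<inter> (L l \<union> f l ` D) = {}" if "k < l" for k l
    proof -
      have "f k ` D \<inter> f l ` D = {}"
        using part_K_disj[of k l] Int_mono[OF f_sub(2)[of k] f_sub(2)[of l]] that by simp
      then show ?thesis
        using L_disj[OF that] L_disj_D[of k l] L_disj_D[of l k]
        by (simp add: Int_Un_distrib Int_Un_distrib2 Int_commute)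
    qed
    then show "disjoint_family (\<lambda>k. L k \<union> f k ` D)"
      unfolding disjoint_family_on_def by (metis Int_commute linorder_neqE_nat)
    show "disjoint_family (\<lambda>k. part (K k))"
      using part_K_disj by (simp add: disjoint_family_on_def)
  qed
  also have "(\<Union>k. part (K k)) = part J"
    by (rule part_K_UN)
  also have "homeo_equiv X (part J) (topspace X)"
    using homeo_equiv_part[OF J, of UNIV] by (simp add: part_UNIV)
  also have "(\<Union>k. L k \<union> f k ` D) = C \<union> part J"
  proof
    show "(\<Union>k. L k \<union> f k ` D) \<subseteq> C \<union> part J"
    proof (intro UN_least Un_least)
      have K_sub: "part (K k) \<subseteq> C \<union> part J" for k
        unfolding part_K_UN[symmetric] by blast
      show "f k ` D \<subseteq> C \<union> part J" for k
        by (rule order_trans[OF f_sub(2) K_sub])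
      show "L k \<subseteq> C \<union> part J" for k
        using order_trans[OF L_sub K_sub] by (cases k) (simp_all add: L_def)
    qed
    have "C \<subseteq> L 0" "\<And>k. part (K k) = L (Suc k) \<union> f k ` D"
      using f_Un by (simp_all add: L_def)
    then show "C \<union> part J \<subseteq> (\<Union>k. L k \<union> f k ` D)"
      unfolding part_K_UN[symmetric] by blast
  qed
  finally show ?thesis .
qed

text \<open>Each complement contains infinitely many pieces and is therefore a copy of the whole
  space by \<open>homeo_equiv_absorb\<close>. So the complements are homeomorphic to each other, and
  any homeomorphism between them can be glued to \<open>f\<close>.\<close>

lemma homeo_extend:
  assumes f: "homeo_between X f A B" and clA: "clopenin X A" and clB: "clopenin X B"
    and I: "infinite I" "A \<inter> part I = {}" and J: "infinite J" "B \<inter> part J = {}"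
  shows "\<exists>g. homeo_between X g (topspace X) (topspace X) \<and> (\<forall>x\<in>A. g x = f x)"
proof -
  have *: "homeo_equiv X (topspace X - A) (topspace X)"
    if "clopenin X A" "infinite I" "A \<inter> part I = {}" for A I
  proof -
    have "topspace X - A = (topspace X - A - part I) \<union> part I"
      using that by (auto simp: part_def)
    then show ?thesis
      using homeo_equiv_absorb[of "topspace X - A - part I" I] that
      by (simp add: clopenin_Diff clopenin_part clopenin_topspace) blast
  qed
  obtain h where h: "homeo_between X h (topspace X - A) (topspace X - B)"
    using homeo_equiv_trans[OF *[OF clA I] homeo_equiv_sym[OF *[OF clB J]]]
    unfolding homeo_equiv_def by blast
  have "openin X A" "openin X (topspace X - A)"
    using clA by (auto simp: clopenin_def)
  then obtain g where "homeo_between X g (A \<union> (topspace X - A)) (B \<union> (topspace X - B))"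
    "\<And>x. x \<in> A \<Longrightarrow> g x = f x"
    using homeo_between_glue2[OF f h] by (metis Diff_disjoint)
  moreover have "A \<union> (topspace X - A) = topspace X" "B \<union> (topspace X - B) = topspace X"
    using clopenin_subset[OF clA] clopenin_subset[OF clB] by auto
  ultimately show ?thesis by auto
qed

end

section \<open>Ultrafilters of clopen sets\<close>

text \<open>These are the points of the Stone space of the Boolean algebra of clopen sets. Upward
  closure is derived from the dichotomy in \<open>clopen_ultrafilter_subset\<close>.\<close>

definition clopen_ultrafilter :: "'a topology \<Rightarrow> 'a set set \<Rightarrow> bool" where
  "clopen_ultrafilter X p \<longleftrightarrow> (\<forall>A\<in>p. clopenin X A) \<and> {} \<notin> p \<and>
     (\<forall>A\<in>p. \<forall>B\<in>p. A \<inter> B \<in> p) \<and> (\<forall>A. clopenin X A \<longrightarrow> A \<in> p \<or> topspace X - A \<in> p)"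

lemma clopen_ultrafilterD:
  assumes "clopen_ultrafilter X p"
  shows clopen_ultrafilter_clopenin: "A \<in> p \<Longrightarrow> clopenin X A"
    and clopen_ultrafilter_empty: "{} \<notin> p"
    and clopen_ultrafilter_Int: "A \<in> p \<Longrightarrow> B \<in> p \<Longrightarrow> A \<inter> B \<in> p"
    and clopen_ultrafilter_cases: "clopenin X A \<Longrightarrow> A \<in> p \<or> topspace X - A \<in> p"
  using assms by (auto simp: clopen_ultrafilter_def)

lemma clopen_ultrafilter_subset:
  assumes p: "clopen_ultrafilter X p" and "A \<in> p" "A \<subseteq> B" "clopenin X B"
  shows "B \<in> p"
proof (rule ccontr)
  assume "B \<notin> p"
  then have "A \<inter> (topspace X - B) \<in> p"
    using assms clopen_ultrafilter_cases[OF p] clopen_ultrafilter_Int[OF p] by blast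
  also have "A \<inter> (topspace X - B) = {}"
    using \<open>A \<subseteq> B\<close> by blast
  finally show False
    using clopen_ultrafilter_empty[OF p] by blast
qed

lemma clopen_ultrafilter_Diff:
  assumes p: "clopen_ultrafilter X p" and "A \<in> p" "B \<notin> p" "clopenin X B"
  shows "A - B \<in> p"
proof -
  have "A \<inter> (topspace X - B) \<in> p"
    using assms clopen_ultrafilter_cases[OF p] clopen_ultrafilter_Int[OF p] by blast
  also have "A \<inter> (topspace X - B) = A - B"
    using clopenin_subset[OF clopen_ultrafilter_clopenin[OF p \<open>A \<in> p\<close>]] by blast
  finally show ?thesis .
qed

lemma clopen_ultrafilter_disjoint:
  "clopen_ultrafilter X p \<Longrightarrow> A \<in> p \<Longrightarrow> A \<inter> B = {} \<Longrightarrow> B \<notin> p"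
  using clopen_ultrafilter_Int clopen_ultrafilter_empty by metis

text \<open>The complement of a member of \<open>q\<close> is outside \<open>q\<close>, hence
  outside \<open>p\<close>, so the dichotomy puts the member itself in \<open>p\<close>. Later this
  yields equality from one inclusion and, for distinct ultrafilters, a member of one outside the
  other.\<close>

lemma clopen_ultrafilter_maximal:
  assumes p: "clopen_ultrafilter X p" and q: "clopen_ultrafilter X q" and "p \<subseteq> q"
  shows "p = q"
proof (rule antisym)
  show "q \<subseteq> p"
  proof
    fix A assume "A \<in> q"
    then have "topspace X - A \<notin> q"
      using clopen_ultrafilter_disjoint[OF q] by blast
    then show "A \<in> p"
      using clopen_ultrafilter_cases[OF p] clopen_ultrafilter_clopenin[OF q \<open>A \<in> q\<close>] \<open>p \<subseteq> q\<close> by blast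
  qed
qed fact

text \<open>Zorn's lemma yields a maximal clopen family with the finite intersection property, and
  maximality gives the ultrafilter laws. The factor \<open>topspace X\<close> is there because the
  intersection of the empty family is \<open>UNIV\<close>.\<close>

lemma clopen_ultrafilter_exists:
  assumes F: "\<And>A. A \<in> F \<Longrightarrow> clopenin X A"
    and fip: "\<And>S. finite S \<Longrightarrow> S \<subseteq> F \<Longrightarrow> topspace X \<inter> \<Inter>S \<noteq> {}"
  shows "\<exists>p. clopen_ultrafilter X p \<and> F \<subseteq> p"
proof -
  define FF where "FF = {p. F \<subseteq> p \<and> p \<subseteq> {A. clopenin X A} \<and>
    (\<forall>S. finite S \<longrightarrow> S \<subseteq> p \<longrightarrow> topspace X \<inter> \<Inter>S \<noteq> {})}"
  have FF_D: "F \<subseteq> p" "\<And>A. A \<in> p \<Longrightarrow> clopenin X A"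
    "\<And>S. finite S \<Longrightarrow> S \<subseteq> p \<Longrightarrow> topspace X \<inter> \<Inter>S \<noteq> {}" if "p \<in> FF" for p
    using that unfolding FF_def by simp_all (metis mem_Collect_eq subsetD)
  have FF_I: "p \<in> FF" if "F \<subseteq> p" "\<And>A. A \<in> p \<Longrightarrow> clopenin X A"
    "\<And>S. finite S \<Longrightarrow> S \<subseteq> p \<Longrightarrow> topspace X \<inter> \<Inter>S \<noteq> {}" for p
    using that by (simp add: FF_def subset_iff)
  have "F \<in> FF"
    by (rule FF_I) (use assms in simp_all)
  have "\<exists>M\<in>FF. \<forall>Y\<in>FF. M \<subseteq> Y \<longrightarrow> Y = M"
  proof (rule subset_Zorn_nonempty)
    fix C assume "C \<noteq> {}" and chain: "subset.chain FF C"
    then have CFF: "C \<subseteq> FF"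
      by (simp add: subset_chain_def)
    show "\<Union>C \<in> FF"
    proof (rule FF_I)
      obtain p where "p \<in> C"
        using \<open>C \<noteq> {}\<close> by blast
      then show "F \<subseteq> \<Union>C"
        using FF_D(1)[of p] CFF by blast
      show "clopenin X A" if "A \<in> \<Union>C" for A
        using that FF_D(2) CFF by blast
      fix S assume S: "finite S" "S \<subseteq> \<Union>C"
      then obtain p where "p \<in> C" "S \<subseteq> p"
        using finite_subset_Union_chain[OF S \<open>C \<noteq> {}\<close> chain] by blast
      then show "topspace X \<inter> \<Inter>S \<noteq> {}"
        using FF_D(3)[of p S] CFF S(1) by blast
    qed
  qed (use \<open>F \<in> FF\<close> in blast)
  then obtain p where pFF: "p \<in> FF" and max: "\<And>Y. Y \<in> FF \<Longrightarrow> p \<subseteq> Y \<Longrightarrow> Y = p"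
    by blast
  note pF = FF_D(1)[OF pFF] and pcl = FF_D(2)[OF pFF] and pfip = FF_D(3)[OF pFF]
  \<comment> \<open>Adding \<open>A\<close> to the maximal family destroys the finite intersection
    property. With \<open>A\<close> taken out, the violating finite set becomes a finite part of
    \<open>p\<close> whose intersection misses \<open>A\<close>.\<close>
  have avoid: "\<exists>S. finite S \<and> S \<subseteq> p \<and> topspace X \<inter> \<Inter>S \<inter> A = {}"
    if "clopenin X A" "A \<notin> p" for A
  proof -
    have "insert A p \<notin> FF"
      using max[of "insert A p"] that by blast
    moreover have "F \<subseteq> insert A p" "\<And>B. B \<in> insert A p \<Longrightarrow> clopenin X B"
      using pF pcl that by auto
    ultimately obtain T where T: "finite T" "T \<subseteq> insert A p" "topspace X \<inter> \<Inter>T = {}"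
      using FF_I[of "insert A p"] by metis
    have "topspace X \<inter> \<Inter>(T - {A}) \<inter> A = {}"
      using T(3) by blast
    with T show ?thesis
      by (intro exI[of _ "T - {A}"]) auto
  qed
  have dich: "A \<in> p \<or> topspace X - A \<in> p" if A: "clopenin X A" for A
  proof (rule ccontr)
    assume "\<not> ?thesis"
    then obtain S T where ST: "finite S" "S \<subseteq> p" "topspace X \<inter> \<Inter>S \<inter> A = {}"
      "finite T" "T \<subseteq> p" "topspace X \<inter> \<Inter>T \<inter> (topspace X - A) = {}"
      using avoid[OF A] avoid[OF clopenin_Diff_topspace[OF A]] by blast
    have "topspace X \<inter> \<Inter>(S \<union> T) = {}"
      using ST(3,6) by auto
    then show False
      using pfip[of "S \<union> T"] ST by simp
  qed
  have "A \<inter> B \<in> p" if "A \<in> p" "B \<in> p" for A B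
  proof (rule ccontr)
    assume "A \<inter> B \<notin> p"
    then have "topspace X - A \<inter> B \<in> p"
      using dich[OF clopenin_Int] pcl that by blast
    then show False
      using pfip[of "{A, B, topspace X - A \<inter> B}"] that by auto
  qed
  moreover have "{} \<notin> p"
    using pfip[of "{{}}"] by auto
  ultimately have "clopen_ultrafilter X p"
    using pcl dich by (simp add: clopen_ultrafilter_def)
  with pF show ?thesis by blast
qed

section \<open>The action of the homeomorphism group on ultrafilters\<close>

text \<open>Bridge from the library notion of homeomorphism to \<open>homeo_between\<close>, in
  which all cutting and gluing is done.\<close>

lemma carrier_homeo_group:
  "g \<in> carrier (homeo_group X) \<longleftrightarrow>
     g \<in> extensional (topspace X) \<and> homeo_between X g (topspace X) (topspace X)"
proof -
  have "homeomorphic_map X X g \<longleftrightarrow> homeo_between X g (topspace X) (topspace X)"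
  proof
    assume g: "homeomorphic_map X X g"
    then have "bij_betw g (topspace X) (topspace X)"
      by (simp add: bij_betw_def homeomorphic_eq_everything_map)
    then show "homeo_between X g (topspace X) (topspace X)"
      using homeomorphic_map_openness[OF g] by (simp add: homeo_between_def)
  next
    assume g: "homeo_between X g (topspace X) (topspace X)"
    then have bij: "bij_betw g (topspace X) (topspace X)"
      by (simp add: homeo_between_def)
    have "open_map X X g"
      using homeo_between_openD[OF g] by (simp add: open_map_def openin_subset)
    moreover have "continuous_map X X g"
      unfolding continuous_map_def
    proof (intro conjI allI impI)
      show "g \<in> topspace X \<rightarrow> topspace X"
        using bij by (rule bij_betw_imp_funcset)
      fix U assume U: "openin X U"
      \<comment> \<open>By surjectivity the preimage of \<open>U\<close> has image exactly
        \<open>U\<close>, so its openness can be read off from that of \<open>U\<close>.\<close>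
      have "g ` {x \<in> topspace X. g x \<in> U} = g ` topspace X \<inter> U"
        by auto
      also have "\<dots> = U"
        using bij_betw_imp_surj_on[OF bij] openin_subset[OF U] by auto
      finally have "g ` {x \<in> topspace X. g x \<in> U} = U" .
      then show "openin X {x \<in> topspace X. g x \<in> U}"
        using homeo_between_openD[OF g, of "{x \<in> topspace X. g x \<in> U}"] U by auto
    qed
    ultimately show "homeomorphic_map X X g"
      using bij by (auto simp: bij_betw_def intro!: bijective_open_imp_homeomorphic_map)
  qed
  then show ?thesis
    by (simp add: homeo_group_def)
qed

lemma mult_homeo_group:
  assumes "g \<in> carrier (homeo_group X)" "h \<in> carrier (homeo_group X)"
  shows "g \<otimes>\<^bsub>homeo_group X\<^esub> h = compose (topspace X) g h"
proof -
  have "g \<in> Bij (topspace X)" "h \<in> Bij (topspace X)"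
    using assms by (auto simp: carrier_homeo_group homeo_between_def Bij_def)
  then show ?thesis
    by (simp add: homeo_group_def BijGroup_def)
qed

lemma one_homeo_group: "\<one>\<^bsub>homeo_group X\<^esub> = (\<lambda>x\<in>topspace X. x)"
  by (simp add: homeo_group_def BijGroup_def)

text \<open>The image ultrafilter. Under a homeomorphism of the whole space the images of the
  members are already all of its members, so no upward closure is taken.\<close>

definition push_family :: "('a \<Rightarrow> 'a) \<Rightarrow> 'a set set \<Rightarrow> 'a set set" where
  "push_family g p = (`) g ` p"

lemma push_family_mult:
  assumes "g \<in> carrier (homeo_group X)" "h \<in> carrier (homeo_group X)"
    and p: "clopen_ultrafilter X p"
  shows "push_family (g \<otimes>\<^bsub>homeo_group X\<^esub> h) p = push_family g (push_family h p)"
proof -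
  have "compose (topspace X) g h ` A = g ` h ` A" if "A \<in> p" for A
  proof -
    have "A \<subseteq> topspace X"
      using clopenin_subset[OF clopen_ultrafilter_clopenin[OF p that]] .
    then show ?thesis
      unfolding image_image by (intro image_cong) (auto simp: compose_def)
  qed
  then show ?thesis
    by (simp add: mult_homeo_group[OF assms(1,2)] push_family_def image_image[of "(`) g"] cong: image_cong_simp)
qed

lemma push_family_one:
  assumes p: "clopen_ultrafilter X p"
  shows "push_family \<one>\<^bsub>homeo_group X\<^esub> p = p"
proof -
  have "(\<lambda>x\<in>topspace X. x) ` A = A" if "A \<in> p" for A
    using clopenin_subset[OF clopen_ultrafilter_clopenin[OF p that]] by force
  then show ?thesis
    by (simp add: push_family_def one_homeo_group)
qed

lemma homeo_between_Diff:
  assumes "homeo_between X g (topspace X) (topspace X)" and "A \<subseteq> topspace X"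
  shows "g ` (topspace X - A) = topspace X - g ` A"
  using assms inj_on_image_set_diff[of g "topspace X" "topspace X" A]
  by (auto simp: homeo_between_def bij_betw_def)

lemma clopenin_image:
  assumes "g \<in> carrier (homeo_group X)" and A: "A \<subseteq> topspace X"
  shows "clopenin X (g ` A) \<longleftrightarrow> clopenin X A"
proof -
  have g: "homeo_between X g (topspace X) (topspace X)"
    using assms(1) by (simp add: carrier_homeo_group)
  show ?thesis
    using homeo_between_openD[OF g A] homeo_between_openD[OF g, of "topspace X - A"]
    by (simp add: clopenin_def flip: homeo_between_Diff[OF g A])
qed

lemma push_family_ultrafilter:
  assumes gG: "g \<in> carrier (homeo_group X)" and p: "clopen_ultrafilter X p"
  shows "clopen_ultrafilter X (push_family g p)"
proof -
  have g: "homeo_between X g (topspace X) (topspace X)"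
    using gG by (simp add: carrier_homeo_group)
  have inj: "inj_on g (topspace X)" and surj: "g ` topspace X = topspace X"
    using g by (auto simp: homeo_between_def bij_betw_def)
  have sub: "A \<subseteq> topspace X" if "A \<in> p" for A
    using clopenin_subset[OF clopen_ultrafilter_clopenin[OF p that]] .
  show ?thesis
    unfolding clopen_ultrafilter_def
  proof (intro conjI ballI allI impI)
    fix A assume "A \<in> push_family g p"
    then show "clopenin X A"
      using clopenin_image[OF gG sub] clopen_ultrafilter_clopenin[OF p] by (auto simp: push_family_def)
  next
    show "{} \<notin> push_family g p"
      using clopen_ultrafilter_empty[OF p] by (auto simp: push_family_def)
  next
    fix A B assume "A \<in> push_family g p" "B \<in> push_family g p"
    then obtain A' B' where "A' \<in> p" "B' \<in> p" "A = g ` A'" "B = g ` B'"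
      by (auto simp: push_family_def)
    then have "A \<inter> B = g ` (A' \<inter> B')" "A' \<inter> B' \<in> p"
      using inj_on_image_Int[OF inj sub sub] clopen_ultrafilter_Int[OF p] by simp_all
    then show "A \<inter> B \<in> push_family g p"
      unfolding push_family_def by (rule image_eqI)
  next
    fix A assume A: "clopenin X A"
    define A' where "A' = {x \<in> topspace X. g x \<in> A}"
    have "g ` A' = g ` topspace X \<inter> A"
      by (auto simp: A'_def)
    then have A': "A' \<subseteq> topspace X" "g ` A' = A"
      using surj clopenin_subset[OF A] by (auto simp: A'_def)
    then have "clopenin X A'"
      using clopenin_image[OF gG A'(1)] A by simp
    then show "A \<in> push_family g p \<or> topspace X - A \<in> push_family g p"
      using clopen_ultrafilter_cases[OF p, of A'] A'(2) homeo_between_Diff[OF g A'(1)]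
        imageI[of A' p "(`) g"] imageI[of "topspace X - A'" p "(`) g"]
      unfolding push_family_def by auto
  qed
qed

text \<open>The members inside \<open>A\<close> determine \<open>p\<close>, so only the behaviour of
  the map near \<open>p\<close> matters. Hence a homeomorphism can be prescribed at an ultrafilter
  by fixing it on a single member.\<close>

lemma push_family_cong:
  assumes gG: "g \<in> carrier (homeo_group X)" and hG: "h \<in> carrier (homeo_group X)"
    and p: "clopen_ultrafilter X p" and A: "A \<in> p" and eq: "\<And>x. x \<in> A \<Longrightarrow> g x = h x"
  shows "push_family g p = push_family h p"
proof (rule clopen_ultrafilter_maximal)
  show "push_family g p \<subseteq> push_family h p"
  proof
    fix B assume "B \<in> push_family g p"
    then obtain Y where Y: "Y \<in> p" "B = g ` Y"
      by (auto simp: push_family_def)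
    have "clopenin X B"
      using clopen_ultrafilter_clopenin[OF push_family_ultrafilter[OF gG p]]
        \<open>B \<in> push_family g p\<close> by blast
    moreover have "h ` (Y \<inter> A) \<in> push_family h p"
      using clopen_ultrafilter_Int[OF p Y(1) A] by (auto simp: push_family_def)
    moreover have "h ` (Y \<inter> A) = g ` (Y \<inter> A)"
      using eq by (intro image_cong) auto
    then have "h ` (Y \<inter> A) \<subseteq> B"
      using Y by auto
    ultimately show "B \<in> push_family h p"
      using clopen_ultrafilter_subset[OF push_family_ultrafilter[OF hG p]] by blast
  qed
qed (rule push_family_ultrafilter[OF gG p] push_family_ultrafilter[OF hG p])+

section \<open>Maximality of stabilizers in an abstract group action\<close>

text \<open>The action need not be transitive, so \<open>two_transitive\<close> only compares \<open>q\<close> with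
  points of its own orbit.\<close>

lemma (in group) stabilizer_maximal_subgroup:
  fixes act :: "'a \<Rightarrow> 'p \<Rightarrow> 'p"
  assumes closed: "\<And>g p. g \<in> carrier G \<Longrightarrow> p \<in> \<Omega> \<Longrightarrow> act g p \<in> \<Omega>"
    and mult: "\<And>g h p. g \<in> carrier G \<Longrightarrow> h \<in> carrier G \<Longrightarrow> p \<in> \<Omega> \<Longrightarrow>
      act (g \<otimes> h) p = act g (act h p)"
    and one: "\<And>p. p \<in> \<Omega> \<Longrightarrow> act \<one> p = p"
    and two_transitive: "\<And>g p q. g \<in> carrier G \<Longrightarrow> p \<in> \<Omega> \<Longrightarrow> q \<in> \<Omega> \<Longrightarrow> q \<noteq> p \<Longrightarrow> act g q \<noteq> p \<Longrightarrow>
      \<exists>k\<in>carrier G. act k p = p \<and> act k q = act g q"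
    and moves: "\<And>p q. p \<in> \<Omega> \<Longrightarrow> q \<in> \<Omega> \<Longrightarrow> \<exists>g\<in>carrier G. act g q \<noteq> q \<and> act g q \<noteq> p"
  shows "p \<in> \<Omega> \<Longrightarrow> maximal_subgroup {g \<in> carrier G. act g p = p} G"
    and "inj_on (\<lambda>p. {g \<in> carrier G. act g p = p}) \<Omega>"
proof -
  define Stab where "Stab p = {g \<in> carrier G. act g p = p}" for p
  have inv_act: "act (inv g) (act g p) = p" if "g \<in> carrier G" "p \<in> \<Omega>" for g p
    using mult[of "inv g" g p] one that by simp
  have sub: "subgroup (Stab p) G" if p: "p \<in> \<Omega>" for p
  proof
    show "inv g \<in> Stab p" if "g \<in> Stab p" for g
      using inv_act[of g p] that p by (simp add: Stab_def)
  qed (use p mult one in \<open>auto simp: Stab_def\<close>)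
  have "maximal_subgroup (Stab p) G" if p: "p \<in> \<Omega>" for p
    unfolding maximal_subgroup_def
  proof (intro conjI notI)
    show "subgroup (Stab p) G"
      using p by (rule sub)
    show False if "Stab p = carrier G"
      using moves[OF p p] that unfolding Stab_def by blast
    assume "\<exists>H. subgroup H G \<and> Stab p \<subset> H \<and> H \<subset> carrier G"
    then obtain H g h where H: "subgroup H G" and MH: "Stab p \<subseteq> H"
      and h: "h \<in> H" "h \<notin> Stab p" and g: "g \<in> carrier G" "g \<notin> H"
      by blast
    then have hG: "h \<in> carrier G"
      using subgroup.mem_carrier[OF H] by blast
    have neq: "act h p \<noteq> p" "act g p \<noteq> p"
      using h g hG MH unfolding Stab_def by blast+
    \<comment> \<open>Neither \<open>act h p\<close> nor \<open>act g p\<close> is \<open>p\<close>,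
      so some \<open>k\<close> fixing \<open>p\<close> carries the first to the second. Then
      \<open>inv g \<otimes> (k \<otimes> h)\<close> fixes \<open>p\<close> as well, and
      \<open>g\<close> is recovered as a product of elements of \<open>H\<close>.\<close>
    have "act (g \<otimes> inv h) (act h p) = act g p"
      using mult[of g "inv h" "act h p"] inv_act[OF hG p] closed g hG p by simp
    then obtain k where k: "k \<in> carrier G" "act k p = p" "act k (act h p) = act g p"
      using two_transitive[of "g \<otimes> inv h" p "act h p"] neq g hG p closed by auto
    have "act (inv g \<otimes> (k \<otimes> h)) p = p"
      using mult[of "inv g" "k \<otimes> h" p] mult[of k h p] k inv_act g hG p by simp
    then have "inv g \<otimes> (k \<otimes> h) \<in> H"
      using MH g k hG by (auto simp: Stab_def)
    moreover have "k \<in> H"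
      using MH k by (auto simp: Stab_def)
    then have "k \<otimes> h \<in> H"
      using subgroup.m_closed[OF H] h by blast
    ultimately have "(k \<otimes> h) \<otimes> inv (inv g \<otimes> (k \<otimes> h)) \<in> H"
      using subgroup.m_closed[OF H] subgroup.m_inv_closed[OF H] by blast
    moreover have "x \<otimes> inv (inv g \<otimes> x) = g" if "x \<in> carrier G" for x
      using that g by (simp add: inv_mult_group m_assoc[symmetric])
    ultimately show False
      using g k hG by simp
  qed
  then show "p \<in> \<Omega> \<Longrightarrow> maximal_subgroup {g \<in> carrier G. act g p = p} G"
    by (simp add: Stab_def)
  have "p = q" if pq: "p \<in> \<Omega>" "q \<in> \<Omega>" "Stab p = Stab q" for p q
  proof (rule ccontr)
    assume "p \<noteq> q"
    \<comment> \<open>Some point of the orbit of \<open>q\<close> is neither \<open>p\<close> nor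
      \<open>q\<close>. The stabilizer of \<open>p\<close> can move \<open>q\<close> there, so it is
      not the stabilizer of \<open>q\<close>.\<close>
    obtain g where g: "g \<in> carrier G" "act g q \<noteq> q" "act g q \<noteq> p"
      using moves[OF pq(1,2)] by blast
    then obtain k where k: "k \<in> carrier G" "act k p = p" "act k q = act g q"
      using two_transitive[of g p q] pq \<open>p \<noteq> q\<close> by blast
    then have "k \<in> Stab p" "k \<notin> Stab q"
      using g by (simp_all add: Stab_def)
    with pq show False by blast
  qed
  then show "inj_on (\<lambda>p. {g \<in> carrier G. act g p = p}) \<Omega>"
    by (simp add: Stab_def inj_on_def)
qed

section \<open>An independent family of sets of naturals\<close>

text \<open>A code \<open>(l, L)\<close> in \<open>S A\<close> says that the trace of \<open>A\<close> on the finite list \<open>l\<close> is one of the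
  finitely many traces listed in \<open>L\<close>; an \<open>l\<close> that separates the given sets gives independence.\<close>

lemma independent_family:
  obtains S :: "nat set \<Rightarrow> nat set"
  where "\<And>P Q. finite P \<Longrightarrow> finite Q \<Longrightarrow> P \<inter> Q = {} \<Longrightarrow>
    \<exists>n. (\<forall>A\<in>P. n \<in> S A) \<and> (\<forall>B\<in>Q. n \<notin> S B)"
proof
  define S :: "nat set \<Rightarrow> nat set"
    where "S A = {n. case from_nat n of (l :: nat list, L) \<Rightarrow> filter (\<lambda>x. x \<in> A) l \<in> set L}" for A
  fix P Q :: "nat set set"
  assume fin: "finite P" "finite Q" and disj: "P \<inter> Q = {}"
  define d where "d A B = (SOME x. (x \<in> A) \<noteq> (x \<in> B))" for A B :: "nat set"
  have d: "(d A B \<in> A) \<noteq> (d A B \<in> B)" if "A \<noteq> B" for A B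
    unfolding d_def by (rule someI_ex) (use that in blast)
  \<comment> \<open>One separating point for each pair in \<open>P \<times> Q\<close> is enough:
    only the traces of members of \<open>P\<close> have to differ from those of members of
    \<open>Q\<close>.\<close>
  have "finite ((\<lambda>(A, B). d A B) ` (P \<times> Q))"
    using fin by simp
  from finite_list[OF this] obtain l where l: "set l = (\<lambda>(A, B). d A B) ` (P \<times> Q)" ..
  from finite_list[OF finite_imageI[OF fin(1)]]
  obtain L where L: "set L = (\<lambda>A. filter (\<lambda>x. x \<in> A) l) ` P" ..
  have "filter (\<lambda>x. x \<in> B) l \<noteq> filter (\<lambda>x. x \<in> A) l" if "A \<in> P" "B \<in> Q" for A B
  proof
    assume "filter (\<lambda>x. x \<in> B) l = filter (\<lambda>x. x \<in> A) l"
    then have "set (filter (\<lambda>x. x \<in> B) l) = set (filter (\<lambda>x. x \<in> A) l)"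
      by simp
    moreover have "d A B \<in> set l"
      using that l by force
    ultimately have "(d A B \<in> A) = (d A B \<in> B)"
      by auto
    moreover have "A \<noteq> B"
      using that disj by blast
    ultimately show False
      using d by blast
  qed
  then have "(\<forall>A\<in>P. to_nat (l, L) \<in> S A) \<and> (\<forall>B\<in>Q. to_nat (l, L) \<notin> S B)"
    using L by (auto simp: S_def)
  then show "\<exists>n. (\<forall>A\<in>P. n \<in> S A) \<and> (\<forall>B\<in>Q. n \<notin> S B)"
    by blast
qed

section \<open>Many ultrafilters, and their stabilizers\<close>

context infinitely_self_similar
begin

text \<open>\<open>\<Phi>\<close> decides for every \<open>A\<close> whether \<open>S A\<close> or
  its complement is taken. By independence finitely many decisions share a whole piece, so some
  ultrafilter obeys them all; two choices of \<open>\<Phi>\<close> that differ at \<open>A\<close>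
  force disjoint members.\<close>

lemma many_clopen_ultrafilters:
  obtains u :: "nat set set \<Rightarrow> 'a set set"
  where "inj u" and "\<And>\<Phi>. clopen_ultrafilter X (u \<Phi>)"
proof -
  obtain S :: "nat set \<Rightarrow> nat set"
    where S: "\<And>P Q. finite P \<Longrightarrow> finite Q \<Longrightarrow> P \<inter> Q = {} \<Longrightarrow>
      \<exists>n. (\<forall>A\<in>P. n \<in> S A) \<and> (\<forall>B\<in>Q. n \<notin> S B)"
    using independent_family by blast
  define F where "F \<Phi> A = part (if A \<in> \<Phi> then S A else - S A)" for \<Phi> A
  have "\<exists>p. clopen_ultrafilter X p \<and> range (F \<Phi>) \<subseteq> p" for \<Phi>
  proof (rule clopen_ultrafilter_exists)
    show "clopenin X A" if "A \<in> range (F \<Phi>)" for A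
      using that by (auto simp: F_def clopenin_part)
    fix W assume W: "finite W" "W \<subseteq> range (F \<Phi>)"
    obtain C where C: "finite C" "W = F \<Phi> ` C"
      using finite_subset_image[OF W] by blast
    obtain n where n: "\<forall>A\<in>C \<inter> \<Phi>. n \<in> S A" "\<forall>A\<in>C - \<Phi>. n \<notin> S A"
      using S[of "C \<inter> \<Phi>" "C - \<Phi>"] C(1) by blast
    obtain x where x: "x \<in> topspace X" "c x = n"
      using fibre_nonempty by blast
    then have "x \<in> F \<Phi> A" if "A \<in> C" for A
      using n that by (simp add: F_def part_def)
    then show "topspace X \<inter> \<Inter>W \<noteq> {}"
      using x(1) C(2) by auto
  qed
  then obtain u where u: "\<And>\<Phi>. clopen_ultrafilter X (u \<Phi>)" "\<And>\<Phi>. range (F \<Phi>) \<subseteq> u \<Phi>"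
    by metis
  have sub: "\<Phi> \<subseteq> \<Psi>" if "u \<Phi> = u \<Psi>" for \<Phi> \<Psi>
  proof (rule subsetI, rule ccontr)
    fix A assume A: "A \<in> \<Phi>" "A \<notin> \<Psi>"
    have "F \<Phi> A \<in> u \<Phi>" "F \<Psi> A \<in> u \<Phi>"
      using u(2)[of \<Phi>] u(2)[of \<Psi>] that by auto
    moreover have "F \<Phi> A \<inter> F \<Psi> A = {}"
      using A by (simp add: F_def part_disjoint)
    ultimately show False
      using clopen_ultrafilter_disjoint[OF u(1)] by blast
  qed
  have "inj u"
    by (rule injI, rule equalityI) (simp_all add: sub)
  with u(1) show thesis
    using that by blast
qed

text \<open>Three classes, since each of two ultrafilters contains one and a further class must stay
  free as the room that an extension needs.\<close>

definition third :: "nat \<Rightarrow> 'a set" where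
  "third i = part {n. n mod 3 = i}"

lemma infinite_residue_class: "i < 3 \<Longrightarrow> infinite {n::nat. n mod 3 = i}"
proof -
  assume "i < 3"
  then have "range (\<lambda>n. 3 * n + i) \<subseteq> {n. n mod 3 = i}"
    by auto
  moreover have "infinite (range (\<lambda>n. 3 * n + i))"
    by (intro range_inj_infinite) (auto simp: inj_def)
  ultimately show ?thesis
    using finite_subset by blast
qed

lemma other_third: "i < 3 \<Longrightarrow> j < 3 \<Longrightarrow> \<exists>m<3. m \<noteq> i \<and> m \<noteq> (j::nat)"
  by presburger

lemma clopenin_third: "clopenin X (third i)"
  by (simp add: third_def clopenin_part)

lemma third_disjoint: "i \<noteq> j \<Longrightarrow> third i \<inter> third j = {}"
  unfolding third_def by (rule part_disjoint) auto

lemma clopen_ultrafilter_third: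
  assumes p: "clopen_ultrafilter X p"
  shows "\<exists>i<3. third i \<in> p"
proof (rule ccontr)
  assume "\<not> ?thesis"
  then have nt: "third i \<notin> p" if "i < 3" for i
    using that by blast
  have "topspace X \<in> p"
    using clopen_ultrafilter_cases[OF p clopenin_topspace] clopen_ultrafilter_empty[OF p] by simp
  then have "topspace X - third 0 - third 1 - third 2 \<in> p"
    by (intro clopen_ultrafilter_Diff[OF p] nt clopenin_third) auto
  also have "topspace X - third 0 - third 1 - third 2 = {}"
  proof -
    have "n mod 3 = 0 \<or> n mod 3 = 1 \<or> n mod 3 = 2" for n :: nat
      by linarith
    then show ?thesis
      by (auto simp: third_def part_def)
  qed
  finally show False
    using clopen_ultrafilter_empty[OF p] by blast
qed

text \<open>A class missed by the domain and one missed by the range are the infinite sets of pieces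
  that \<open>homeo_extend\<close> asks for. Restriction makes the extended map extensional, as the
  group demands.\<close>

lemma homeo_group_extend:
  assumes f: "homeo_between X f A B" and clA: "clopenin X A" and clB: "clopenin X B"
    and i: "i < 3" "A \<inter> third i = {}" and j: "j < 3" "B \<inter> third j = {}"
  obtains g where "g \<in> carrier (homeo_group X)" and "\<And>x. x \<in> A \<Longrightarrow> g x = f x"
proof -
  obtain g where g: "homeo_between X g (topspace X) (topspace X)" "\<forall>x\<in>A. g x = f x"
    using homeo_extend[OF f clA clB infinite_residue_class[OF i(1)] _ infinite_residue_class[OF j(1)]]
      i(2) j(2) unfolding third_def by blast
  have "homeo_between X (restrict g (topspace X)) (topspace X) (topspace X)"
    using homeo_between_cong[of "topspace X" "restrict g (topspace X)" g X "topspace X"] g(1) by simp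
  then have "restrict g (topspace X) \<in> carrier (homeo_group X)"
    by (simp add: carrier_homeo_group)
  moreover have "restrict g (topspace X) x = f x" if "x \<in> A" for x
    using g(2) that clopenin_subset[OF clA] by auto
  ultimately show thesis
    using that by blast
qed

text \<open>\<open>q\<close> is carried from its own class to one that neither \<open>p\<close> nor
  \<open>q\<close> contains. Each of these two classes is also the room that the other leaves for
  the extension.\<close>

lemma push_family_moves:
  assumes p: "clopen_ultrafilter X p" and q: "clopen_ultrafilter X q"
  shows "\<exists>g\<in>carrier (homeo_group X). push_family g q \<noteq> q \<and> push_family g q \<noteq> p"
proof -
  obtain i where i: "i < 3" "third i \<in> p"
    using clopen_ultrafilter_third[OF p] by blast
  obtain j where j: "j < 3" "third j \<in> q"
    using clopen_ultrafilter_third[OF q] by blast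
  obtain l where l: "l < 3" "l \<noteq> i" "l \<noteq> j"
    using other_third[OF i(1) j(1)] by blast
  obtain f where f: "homeo_between X f (third j) (third l)"
    using homeo_equiv_part[OF infinite_residue_class[OF j(1)] infinite_residue_class[OF l(1)]]
    unfolding homeo_equiv_def third_def by blast
  obtain g where g: "g \<in> carrier (homeo_group X)" "\<And>x. x \<in> third j \<Longrightarrow> g x = f x"
    using homeo_group_extend[OF f clopenin_third clopenin_third l(1) _ j(1)]
      third_disjoint[of j l] third_disjoint[of l j] l(3) by blast
  have "g ` third j = third l"
    using homeo_between_imageD[OF f] g(2) by (simp cong: image_cong_simp)
  then have "third l \<in> push_family g q"
    using j(2) by (auto simp: push_family_def)
  moreover have "third l \<notin> p" "third l \<notin> q"
    using clopen_ultrafilter_disjoint[OF p i(2)] clopen_ultrafilter_disjoint[OF q j(2)]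
      third_disjoint l by auto
  ultimately show ?thesis
    using g(1) by blast
qed

text \<open>\<open>k\<close> is to be the identity on a member \<open>A\<close> of \<open>p\<close>
  and to equal \<open>g\<close> on a member \<open>B\<close> of \<open>q\<close>. Gluing requires
  \<open>A\<close> to avoid both \<open>B\<close> and its image under \<open>g\<close>, and
  extending requires a free class on each side; shrinking \<open>A\<close> and \<open>B\<close>
  achieves both.\<close>

lemma push_family_two_transitive:
  assumes g: "g \<in> carrier (homeo_group X)"
    and p: "clopen_ultrafilter X p" and q: "clopen_ultrafilter X q"
    and "q \<noteq> p" and "push_family g q \<noteq> p"
  shows "\<exists>k\<in>carrier (homeo_group X). push_family k p = p \<and> push_family k q = push_family g q"
proof -
  define r where "r = push_family g q"
  have r: "clopen_ultrafilter X r"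
    unfolding r_def by (rule push_family_ultrafilter[OF g q])
  obtain i where i: "i < 3" "third i \<in> p"
    using clopen_ultrafilter_third[OF p] by blast
  obtain j where j: "j < 3" "third j \<in> q"
    using clopen_ultrafilter_third[OF q] by blast
  obtain l where l: "l < 3" "third l \<in> r"
    using clopen_ultrafilter_third[OF r] by blast
  \<comment> \<open>\<open>B0\<close>, and \<open>B1\<close> below, separate \<open>q\<close> and
    its image \<open>r\<close> from \<open>p\<close>; this is where \<open>q \<noteq> p\<close> and
    \<open>push_family g q \<noteq> p\<close> enter.\<close>
  obtain B0 where B0: "B0 \<in> q" "B0 \<notin> p"
    using clopen_ultrafilter_maximal[OF q p] \<open>q \<noteq> p\<close> by blast
  obtain B1 where B1: "B1 \<in> r" "B1 \<notin> p"
    using clopen_ultrafilter_maximal[OF r p] assms(5) by (auto simp: r_def)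
  have "B1 \<inter> third l \<in> r"
    using clopen_ultrafilter_Int[OF r B1(1) l(2)] .
  then obtain C where C: "C \<in> q" "g ` C = B1 \<inter> third l"
    by (auto simp: r_def push_family_def)
  \<comment> \<open>\<open>B0\<close> keeps \<open>B\<close> out of \<open>p\<close>,
    \<open>third j\<close> keeps it in one class, and \<open>C\<close> confines its image to
    \<open>B1\<close> and to the class \<open>third l\<close>.\<close>
  define B where "B = B0 \<inter> third j \<inter> C"
  have Bq: "B \<in> q"
    unfolding B_def by (intro clopen_ultrafilter_Int[OF q] B0 j C)
  then have gBr: "g ` B \<in> r"
    by (auto simp: r_def push_family_def)
  have gB_sub: "g ` B \<subseteq> B1 \<inter> third l"
    using C(2) by (auto simp: B_def)
  have clB: "clopenin X B" and clgB: "clopenin X (g ` B)"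
    using clopen_ultrafilter_clopenin[OF q Bq] clopen_ultrafilter_clopenin[OF r gBr] .
  have "B \<notin> p" "g ` B \<notin> p"
    using clopen_ultrafilter_subset[OF p _ _ clopen_ultrafilter_clopenin[OF q B0(1)], of B] B0(2)
      clopen_ultrafilter_subset[OF p _ _ clopen_ultrafilter_clopenin[OF r B1(1)], of "g ` B"] B1(2)
      gB_sub by (auto simp: B_def)
  define A where "A = third i - B - g ` B"
  have Ap: "A \<in> p"
    unfolding A_def by (intro clopen_ultrafilter_Diff[OF p] i \<open>B \<notin> p\<close> \<open>g ` B \<notin> p\<close> clB clgB)
  then have clA: "clopenin X A"
    by (rule clopen_ultrafilter_clopenin[OF p])
  have gXX: "homeo_between X g (topspace X) (topspace X)"
    using g by (simp add: carrier_homeo_group)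
  have gB: "homeo_between X g B (g ` B)"
    by (rule homeo_between_subset[OF gXX clopenin_subset[OF clB]])
  have "A \<inter> B = {}" "A \<inter> g ` B = {}"
    by (auto simp: A_def)
  then obtain f where f: "homeo_between X f (A \<union> B) (A \<union> g ` B)"
    "\<And>x. x \<in> A \<Longrightarrow> f x = x" "\<And>x. x \<in> B \<Longrightarrow> f x = g x"
    using homeo_between_glue2[OF homeo_between_id gB clopenin_openin[OF clA] clopenin_openin[OF clB]]
    by auto
  \<comment> \<open>The domain lies in the classes \<open>i\<close> and \<open>j\<close>, the range
    in \<open>i\<close> and \<open>l\<close>, so the two free classes are chosen separately.\<close>
  obtain m where m: "m < 3" "m \<noteq> i" "m \<noteq> j"
    using other_third[OF i(1) j(1)] by blast
  obtain m' where m': "m' < 3" "m' \<noteq> i" "m' \<noteq> l"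
    using other_third[OF i(1) l(1)] by blast
  have "(A \<union> B) \<inter> third m = {}"
    using third_disjoint[of i m] third_disjoint[of j m] m by (auto simp: A_def B_def)
  moreover have "(A \<union> g ` B) \<inter> third m' = {}"
    using third_disjoint[of i m'] third_disjoint[of l m'] m' gB_sub by (auto simp: A_def)
  ultimately obtain k where k: "k \<in> carrier (homeo_group X)" "\<And>x. x \<in> A \<union> B \<Longrightarrow> k x = f x"
    using homeo_group_extend[OF f(1) clopenin_Un[OF clA clB] clopenin_Un[OF clA clgB] m(1) _ m'(1)]
    by blast
  have "\<one>\<^bsub>homeo_group X\<^esub> \<in> carrier (homeo_group X)"
    using group.is_monoid[OF group_homeo_group] by (rule monoid.one_closed)
  moreover have "k x = \<one>\<^bsub>homeo_group X\<^esub> x" if "x \<in> A" for x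
    using k(2) f(2) that clopenin_subset[OF clA] by (auto simp: one_homeo_group)
  ultimately have "push_family k p = push_family \<one>\<^bsub>homeo_group X\<^esub> p"
    by (intro push_family_cong[OF k(1) _ p Ap])
  then have "push_family k p = p"
    by (simp add: push_family_one[OF p])
  moreover have "push_family k q = push_family g q"
    using k(2) f(3) by (intro push_family_cong[OF k(1) g q Bq]) auto
  ultimately show ?thesis
    using k(1) by blast
qed

theorem has_two_to_continuum_maximal_subgroups_homeo_group:
  assumes "carrier (homeo_group X) \<lesssim> (UNIV :: nat set set)"
  shows "has_two_to_continuum_maximal_subgroups (homeo_group X)"
  unfolding has_two_to_continuum_maximal_subgroups_def
proof (rule lepoll_antisym)
  let ?G = "homeo_group X" and ?U = "{p. clopen_ultrafilter X p}"
  let ?stab = "\<lambda>p. {g \<in> carrier (homeo_group X). push_family g p = p}"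
  interpret group ?G
    by (rule group_homeo_group)
  note stabilizer = stabilizer_maximal_subgroup[where act = push_family and \<Omega> = ?U,
      unfolded mem_Collect_eq, OF push_family_ultrafilter push_family_mult push_family_one
        push_family_two_transitive push_family_moves]
  obtain u :: "nat set set \<Rightarrow> 'a set set"
    where u: "inj u" "\<And>\<Phi>. clopen_ultrafilter X (u \<Phi>)"
    using many_clopen_ultrafilters by blast
  have "inj (?stab \<circ> u)"
    using u by (intro comp_inj_on inj_on_subset[OF stabilizer(2)]) auto
  moreover have "(?stab \<circ> u) ` UNIV \<subseteq> {M. maximal_subgroup M ?G}"
    using stabilizer(1) u(2) by auto
  ultimately show "Pow (UNIV :: nat set set) \<lesssim> {M. maximal_subgroup M ?G}"
    unfolding lepoll_def Pow_UNIV by blast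
  obtain e :: "('a \<Rightarrow> 'a) \<Rightarrow> nat set" where e: "inj_on e (carrier ?G)"
    using assms unfolding lepoll_def by blast
  have "{M. maximal_subgroup M ?G} \<subseteq> Pow (carrier ?G)"
    by (auto simp: maximal_subgroup_def dest: subgroup.mem_carrier)
  then have "inj_on ((`) e) {M. maximal_subgroup M ?G}"
    using inj_on_image_Pow[OF e] inj_on_subset by blast
  then show "{M. maximal_subgroup M ?G} \<lesssim> Pow (UNIV :: nat set set)"
    unfolding lepoll_def by auto
qed

end

section \<open>Bounding the size of a homeomorphism group\<close>

text \<open>An instance of c to the power aleph_0 being c: \<open>e\<close> turns the values on
  \<open>C\<close> into countably many sets of naturals, and pairing with the index of the argument
  merges these into one set. \<open>C\<close> will be the whole space or a countable dense
  set.\<close>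

lemma carrier_homeo_group_lepoll:
  fixes X :: "'a topology"
  assumes C: "countable C"
    and det: "\<And>f g. f \<in> carrier (homeo_group X) \<Longrightarrow> g \<in> carrier (homeo_group X) \<Longrightarrow>
      (\<And>x. x \<in> C \<Longrightarrow> f x = g x) \<Longrightarrow> f = g"
    and CX: "C \<subseteq> topspace X" and X: "topspace X \<lesssim> (UNIV :: nat set set)"
  shows "carrier (homeo_group X) \<lesssim> (UNIV :: nat set set)"
proof -
  obtain e :: "'a \<Rightarrow> nat set" where e: "inj_on e (topspace X)"
    using X unfolding lepoll_def by blast
  define code where "code f = {prod_encode (to_nat_on C x, m) | x m. x \<in> C \<and> m \<in> e (f x)}" for f
  have code: "prod_encode (to_nat_on C x, m) \<in> code f \<longleftrightarrow> m \<in> e (f x)" if "x \<in> C" for x m f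
    using that C unfolding code_def by auto
  have "inj_on code (carrier (homeo_group X))"
  proof (rule inj_onI, rule det)
    fix f g x assume f: "f \<in> carrier (homeo_group X)" and g: "g \<in> carrier (homeo_group X)"
      and eq: "code f = code g" and x: "x \<in> C"
    have "e (f x) = e (g x)"
      using code[OF x, of _ f] code[OF x, of _ g] eq by auto
    moreover have "f x \<in> topspace X" "g x \<in> topspace X"
      using f g x CX imageI[of x "topspace X" f] imageI[of x "topspace X" g]
      by (auto simp: carrier_homeo_group dest!: homeo_between_imageD)
    ultimately show "f x = g x"
      using e by (simp add: inj_on_def)
  qed
  then show ?thesis
    unfolding lepoll_def by blast
qed

lemma homeo_group_eqI:
  assumes "f \<in> carrier (homeo_group X)" "g \<in> carrier (homeo_group X)"
    and "\<And>x. x \<in> topspace X \<Longrightarrow> f x = g x"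
  shows "f = g"
  using assms by (intro extensionalityI[of f "topspace X" g]) (auto simp: carrier_homeo_group)

lemma countable_lepoll_nat_sets:
  assumes "countable A" shows "A \<lesssim> (UNIV :: nat set set)"
proof -
  have "inj_on (\<lambda>x. {to_nat_on A x}) A"
    using inj_on_to_nat_on[OF assms] by (simp add: inj_on_def)
  then show ?thesis
    unfolding lepoll_def by blast
qed

lemma carrier_homeo_group_lepoll_countable:
  assumes "countable (topspace X)"
  shows "carrier (homeo_group X) \<lesssim> (UNIV :: nat set set)"
  by (rule carrier_homeo_group_lepoll[OF assms homeo_group_eqI order_refl
        countable_lepoll_nat_sets[OF assms]])

lemma carrier_homeo_group_lepoll_separable:
  assumes sep: "separable_space X" and haus: "Hausdorff_space X"
    and X: "topspace X \<lesssim> (UNIV :: nat set set)"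
  shows "carrier (homeo_group X) \<lesssim> (UNIV :: nat set set)"
proof -
  obtain C where C: "countable C" "C \<subseteq> topspace X" "X closure_of C = topspace X"
    using sep unfolding separable_space_def by blast
  show ?thesis
  proof (rule carrier_homeo_group_lepoll[OF C(1) _ C(2) X])
    fix f g assume f: "f \<in> carrier (homeo_group X)" and g: "g \<in> carrier (homeo_group X)"
      and eq: "\<And>x. x \<in> C \<Longrightarrow> f x = g x"
    have "continuous_map X X f" "continuous_map X X g"
      using f g by (auto simp: homeo_group_def homeomorphic_imp_continuous_map)
    then show "f = g"
      using C(3) by (intro homeo_group_eqI[OF f g] forall_in_closure_of_eq[OF _ haus _ _ eq]) auto
  qed
qed

section \<open>The discrete naturals and the rationals\<close>

text \<open>Allows pieces to be compared by a translation or a swap of the whole space instead of a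
  map built on one piece.\<close>

lemma homeo_equiv_image:
  assumes f: "homeomorphic_map X X f" and "A \<subseteq> topspace X"
  shows "homeo_equiv X A (f ` A)"
proof -
  have "inj_on f A"
    using f assms(2) by (meson homeomorphic_imp_injective_map inj_on_subset)
  then have "homeo_between X f A (f ` A)"
    using homeomorphic_map_openness[OF f] assms(2)
    unfolding homeo_between_def by (simp add: bij_betw_def)
  then show ?thesis
    unfolding homeo_equiv_def by blast
qed

lemma homeo_group_discrete:
  "BijGroup UNIV = homeo_group (discrete_topology (UNIV :: 'a set))"
proof -
  have "f \<in> Bij UNIV \<longleftrightarrow> homeomorphic_map (discrete_topology UNIV) (discrete_topology UNIV) f"
    for f :: "'a \<Rightarrow> 'a"
    by (auto simp: Bij_def bij_betw_def homeomorphic_eq_everything_map open_map_def closed_map_def)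
  then have "Bij (UNIV :: 'a set) =
      {f. homeomorphic_map (discrete_topology UNIV) (discrete_topology UNIV) f}"
    by blast
  then show ?thesis
    by (simp add: homeo_group_def BijGroup_def)
qed

lemma maximal_subgroups_discrete:
  "has_two_to_continuum_maximal_subgroups (homeo_group (discrete_topology (UNIV :: nat set)))"
proof -
  have "homeo_between (discrete_topology UNIV) (\<lambda>_. n) {0} {n}" for n :: nat
    by (auto simp: homeo_between_def bij_betw_def)
  \<comment> \<open>With the labelling \<open>id\<close> the pieces are single points.\<close>
  then interpret infinitely_self_similar "discrete_topology UNIV" id
    by unfold_locales (auto simp: homeo_equiv_def)
  show ?thesis
    by (intro has_two_to_continuum_maximal_subgroups_homeo_group
        carrier_homeo_group_lepoll_countable) simp
qed

lemma maximal_subgroups_rationals: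
  "has_two_to_continuum_maximal_subgroups (homeo_group (top_of_set (\<rat> :: real set)))"
proof -
  let ?X = "top_of_set (\<rat> :: real set)"
  \<comment> \<open>The cuts, integers minus \<open>a\<close>, must miss the rationals; then the
    fibres of the floor function become traces of open intervals. \<open>int_encode\<close> numbers
    these intervals by naturals.\<close>
  obtain a :: real where a: "a \<notin> \<rat>"
    using countable_rat uncountable_UNIV_real by (metis UNIV_eq_I)
  define c where "c x = int_encode \<lfloor>x + a\<rfloor>" for x
  have fibre: "{x \<in> topspace ?X. c x = n} = \<rat> \<inter> {of_int (int_decode n) - a <..< of_int (int_decode n) + 1 - a}"
    (is "?F n = ?R n") for n
  proof -
    have "c x = n \<longleftrightarrow> \<lfloor>x + a\<rfloor> = int_decode n" for x
      unfolding c_def by (metis int_decode_inverse int_encode_inverse)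
    moreover have "x + a \<noteq> of_int k" if "x \<in> \<rat>" for x k
      using a that by (metis Rats_diff Rats_of_int add_diff_cancel_left')
    moreover have "of_int k - a \<notin> \<rat>" for k
      using a Rats_diff[of "of_int k" "of_int k - a"] by auto
    ultimately show ?thesis
      by (force simp: floor_eq_iff less_le)
  qed
  interpret infinitely_self_similar ?X c
  proof
    fix n
    show "openin ?X (?F n)"
      unfolding fibre by (intro openin_open_Int) auto
    obtain x where "x \<in> \<rat>" "of_int (int_decode n) - a < x" "x < of_int (int_decode n) + 1 - a"
      using Rats_dense_in_real[of "of_int (int_decode n) - a" "of_int (int_decode n) + 1 - a"] by auto
    then show "\<exists>x\<in>topspace ?X. c x = n"
      using fibre[of n] by auto
    \<comment> \<open>Piece \<open>n\<close> is piece 0 translated by this integer, since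
      \<open>int_decode 0\<close> is 0.\<close>
    define k where "k = (of_int (int_decode n) :: real)"
    have shift: "continuous_map ?X ?X (\<lambda>x. x + of_int l)" for l
      by (auto intro!: continuous_intros)
    have "homeomorphic_maps ?X ?X (\<lambda>x. x + of_int (int_decode n)) (\<lambda>x. x + of_int (- int_decode n))"
      unfolding homeomorphic_maps_def by (intro conjI shift) auto
    then have "homeomorphic_map ?X ?X (\<lambda>x. x + k)"
      unfolding k_def homeomorphic_map_maps by blast
    then have "homeo_equiv ?X (?F 0) ((\<lambda>x. x + k) ` ?F 0)"
      by (rule homeo_equiv_image) auto
    also have "(\<lambda>x. x + k) ` ?F 0 = ?F n"
    proof -
      have "x \<in> (\<lambda>x. x + k) ` ?R 0" if "x \<in> ?R n" for x
        using that by (intro image_eqI[of _ _ "x - k"]) (auto simp: k_def int_decode_def sum_decode_def)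
      moreover have "(\<lambda>x. x + k) ` ?R 0 \<subseteq> ?R n"
        by (auto simp: k_def int_decode_def sum_decode_def)
      ultimately show ?thesis
        unfolding fibre by blast
    qed
    finally show "homeo_equiv ?X (?F 0) (?F n)" .
  qed
  show ?thesis
    by (intro has_two_to_continuum_maximal_subgroups_homeo_group
        carrier_homeo_group_lepoll_countable) (simp add: countable_rat)
qed

section \<open>Baire space and the product of the naturals with Cantor space\<close>

text \<open>A basic open set constrains only finitely many coordinates, so finite lists padded with
  the fixed value \<open>undefined\<close> form a countable dense set.\<close>

lemma separable_space_product_discrete:
  "separable_space (product_topology (\<lambda>_::nat. discrete_topology (UNIV :: 'a::countable set)) UNIV)"
  (is "separable_space ?X")
proof -
  define C :: "(nat \<Rightarrow> 'a) set" where "C = range (\<lambda>l n. if n < length l then l ! n else undefined)"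
  have "x \<in> ?X closure_of C" for x
    unfolding in_closure_of
  proof (intro conjI allI impI)
    fix T assume "x \<in> T \<and> openin ?X T"
    then obtain U where U: "finite {i. U i \<noteq> UNIV}" "x \<in> Pi\<^sub>E UNIV U" "Pi\<^sub>E UNIV U \<subseteq> T"
      by (auto simp: openin_product_topology_alt)
    obtain N where N: "\<And>i. U i \<noteq> UNIV \<Longrightarrow> i < N"
      using U(1) unfolding finite_nat_set_iff_bounded by blast
    define y where "y n = (if n < length (map x [0..<N]) then map x [0..<N] ! n else undefined)" for n
    have "y n \<in> U n" for n
      using U(2) N[of n] by (cases "U n = UNIV") (auto simp: y_def)
    then have "y \<in> T"
      using U(3) by (auto simp: PiE_UNIV_domain)
    moreover have "y \<in> C"
      unfolding C_def y_def by blast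
    ultimately show "\<exists>y. y \<in> C \<and> y \<in> T" by blast
  qed simp
  then have "?X closure_of C = topspace ?X"
    by auto
  moreover have "countable C"
    by (simp add: C_def)
  ultimately show ?thesis
    unfolding separable_space_def by (intro exI[of _ C]) simp
qed

lemma nat_fun_lepoll_nat_sets: "(UNIV :: (nat \<Rightarrow> nat) set) \<lesssim> (UNIV :: nat set set)"
proof -
  have "inj (\<lambda>f::nat \<Rightarrow> nat. range (\<lambda>n. prod_encode (n, f n)))"
  proof (rule injI, rule ext)
    fix f g :: "nat \<Rightarrow> nat" and n
    assume "range (\<lambda>n. prod_encode (n, f n)) = range (\<lambda>n. prod_encode (n, g n))"
    then have "prod_encode (n, f n) \<in> range (\<lambda>n. prod_encode (n, g n))"
      by blast
    then show "f n = g n"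
      by auto
  qed
  then show ?thesis
    unfolding lepoll_def by blast
qed

lemma homeomorphic_map_involution:
  assumes "continuous_map X X f" "\<And>x. x \<in> topspace X \<Longrightarrow> f (f x) = x"
  shows "homeomorphic_map X X f"
  using assms unfolding homeomorphic_map_maps homeomorphic_maps_def by blast

lemma maximal_subgroups_baire:
  "has_two_to_continuum_maximal_subgroups (homeo_group baire_space)"
proof -
  interpret infinitely_self_similar baire_space "\<lambda>f. f 0"
  proof
    fix n :: nat
    have proj: "continuous_map baire_space (discrete_topology UNIV) (\<lambda>f. f k)" for k
      using continuous_map_product_projection[of k UNIV "\<lambda>_. discrete_topology UNIV"] by simp
    show "openin baire_space {x \<in> topspace baire_space. x 0 = n}"
      using openin_continuous_map_preimage[OF proj, of "{n}"] by simp
    show "\<exists>x\<in>topspace baire_space. x 0 = n"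
      by (intro bexI[of _ "\<lambda>_. n"]) auto
    \<comment> \<open>Exchanging 0 and \<open>n\<close> in the first coordinate is an involution, so
      continuity alone makes it a homeomorphism; it swaps the two pieces.\<close>
    define F where "F f = f(0 := Transposition.transpose 0 n (f 0))" for f :: "nat \<Rightarrow> nat"
    have "continuous_map baire_space (discrete_topology UNIV) (\<lambda>f. F f k)" for k
    proof (cases "k = 0")
      case True
      have "continuous_map baire_space (discrete_topology UNIV) (Transposition.transpose 0 n \<circ> (\<lambda>f. f 0))"
        by (rule continuous_map_compose[OF proj]) auto
      then show ?thesis
        using True by (simp add: F_def o_def)
    qed (simp add: F_def proj)
    then have "homeomorphic_map baire_space baire_space F"
      by (intro homeomorphic_map_involution) (simp_all add: continuous_map_componentwise_UNIV F_def)
    then have "homeo_equiv baire_space {x \<in> topspace baire_space. x 0 = 0}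
        (F ` {x \<in> topspace baire_space. x 0 = 0})"
      by (rule homeo_equiv_image) auto
    also have "F ` {x \<in> topspace baire_space. x 0 = 0} = {x \<in> topspace baire_space. x 0 = n}"
    proof -
      have "x = F (F x) \<and> F x 0 = 0" if "x 0 = n" for x
        using that by (simp add: F_def fun_eq_iff)
      moreover have "F x 0 = n" if "x 0 = 0" for x
        using that by (simp add: F_def)
      ultimately show ?thesis
        by (auto intro!: image_eqI)
    qed
    finally show "homeo_equiv baire_space {x \<in> topspace baire_space. x 0 = 0}
      {x \<in> topspace baire_space. x 0 = n}" .
  qed
  show ?thesis
    by (intro has_two_to_continuum_maximal_subgroups_homeo_group
        carrier_homeo_group_lepoll_separable separable_space_product_discrete)
      (simp_all add: Hausdorff_space_product_topology nat_fun_lepoll_nat_sets)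
qed

lemma maximal_subgroups_nat_times_cantor:
  "has_two_to_continuum_maximal_subgroups
     (homeo_group (prod_topology (discrete_topology (UNIV :: nat set)) cantor_space))"
proof -
  let ?D = "discrete_topology (UNIV :: nat set)"
  let ?X = "prod_topology ?D cantor_space"
  interpret infinitely_self_similar ?X fst
  proof
    fix n :: nat
    show "openin ?X {x \<in> topspace ?X. fst x = n}"
      using openin_continuous_map_preimage[OF continuous_map_fst, of ?D "{n}" cantor_space] by simp
    show "\<exists>x\<in>topspace ?X. fst x = n"
      by (intro bexI[of _ "(n, \<lambda>_. True)"]) auto
    define F :: "nat \<times> (nat \<Rightarrow> bool) \<Rightarrow> nat \<times> (nat \<Rightarrow> bool)"
      where "F x = (Transposition.transpose 0 n (fst x), snd x)" for x
    have "continuous_map ?X ?D (Transposition.transpose 0 n \<circ> fst)"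
      by (rule continuous_map_compose[OF continuous_map_fst]) auto
    then have "continuous_map ?X ?X F"
      unfolding F_def by (intro continuous_map_pairedI continuous_map_snd) (simp add: o_def)
    then have "homeomorphic_map ?X ?X F"
      by (intro homeomorphic_map_involution) (simp_all add: F_def)
    then have "homeo_equiv ?X {x \<in> topspace ?X. fst x = 0} (F ` {x \<in> topspace ?X. fst x = 0})"
      by (rule homeo_equiv_image) auto
    also have "F ` {x \<in> topspace ?X. fst x = 0} = {x \<in> topspace ?X. fst x = n}"
    proof -
      have "x = F (F x) \<and> fst (F x) = 0" if "fst x = n" for x
        using that by (cases x) (simp add: F_def)
      moreover have "fst (F x) = n" if "fst x = 0" for x
        using that by (simp add: F_def)
      ultimately show ?thesis
        by (auto intro!: image_eqI)
    qed
    finally show "homeo_equiv ?X {x \<in> topspace ?X. fst x = 0} {x \<in> topspace ?X. fst x = n}" .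
  qed
  obtain C :: "(nat \<Rightarrow> bool) set" where C: "countable C" "cantor_space closure_of C = topspace cantor_space"
    using separable_space_product_discrete unfolding separable_space_def by blast
  have "separable_space ?X"
    unfolding separable_space_def
    using C by (intro exI[of _ "UNIV \<times> C"]) (simp add: closure_of_Times)
  moreover have "Hausdorff_space ?X"
    by (simp add: Hausdorff_space_prod_topology Hausdorff_space_product_topology)
  moreover have "topspace ?X \<lesssim> (UNIV :: nat set set)"
  proof -
    \<comment> \<open>A pair becomes one set of naturals: tag 0 carries the number \<open>m\<close>,
      tag 1 the positions at which \<open>b\<close> holds.\<close>
    have "inj (\<lambda>(m, b). {prod_encode (0, m)} \<union> {prod_encode (1, n) | n. b n})"
    proof (rule injI, clarsimp)
      fix m m' and b b' :: "nat \<Rightarrow> bool"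
      assume eq: "insert (prod_encode (0, m)) {prod_encode (Suc 0, n) |n. b n} =
        insert (prod_encode (0, m')) {prod_encode (Suc 0, n) |n. b' n}"
      have "b n = b' n" for n
        using arg_cong[OF eq, of "\<lambda>A. prod_encode (Suc 0, n) \<in> A"] by simp
      moreover have "m = m'"
        using arg_cong[OF eq, of "\<lambda>A. prod_encode (0, m) \<in> A"] by simp
      ultimately show "m = m' \<and> b = b'"
        by blast
    qed
    then have "(UNIV :: (nat \<times> (nat \<Rightarrow> bool)) set) \<lesssim> (UNIV :: nat set set)"
      unfolding lepoll_def by blast
    then show ?thesis
      by simp
  qed
  ultimately show ?thesis
    by (intro has_two_to_continuum_maximal_subgroups_homeo_group carrier_homeo_group_lepoll_separable)
qed

section \<open>The ordinal omega^2\<close>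

text \<open>Zero and the successors are isolated, while the limit \<open>(Suc n, 0)\<close> is the
  supremum of column \<open>n\<close> and has the tails of that column, with the limit added, as a
  neighbourhood base. So only limits impose a condition.\<close>

lemma openin_omega_squared:
  "openin omega_squared U \<longleftrightarrow> (\<forall>n. (Suc n, 0) \<in> U \<longrightarrow> (\<exists>k. \<forall>m\<ge>k. (n, m) \<in> U))"
proof
  let ?r = "less_than <*lex*> less_than"
  let ?B = "insert UNIV (range (\<lambda>a. {x. (x, a) \<in> ?r}) \<union> range (\<lambda>a. {x. (a, x) \<in> ?r}))"
  assume "openin omega_squared U"
  then have "generate_topology_on ?B U"
    unfolding omega_squared_def order_topology_of_def by (rule openin_topology_generated_by)
  then show "\<forall>n. (Suc n, 0) \<in> U \<longrightarrow> (\<exists>k. \<forall>m\<ge>k. (n, m) \<in> U)"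
  proof induction
    case (Int U V)
    show ?case
    proof (intro allI impI)
      fix n assume "(Suc n, 0) \<in> U \<inter> V"
      then obtain k l where "\<forall>m\<ge>k. (n, m) \<in> U" "\<forall>m\<ge>l. (n, m) \<in> V"
        using Int.IH by blast
      then show "\<exists>k. \<forall>m\<ge>k. (n, m) \<in> U \<inter> V"
        by (intro exI[of _ "max k l"]) auto
    qed
  next
    case (UN K)
    then show ?case by (meson Union_iff)
  next
    case (Basis s)
    then consider "s = UNIV" | i j where "s = {x. (x, (i, j)) \<in> ?r}" | i j where "s = {x. ((i, j), x) \<in> ?r}"
      by force
    then show ?case
    proof cases
      \<comment> \<open>A limit above \<open>(i, j)\<close> closes column \<open>i\<close> or a
        later one, and the entries of such a column from \<open>Suc j\<close> on lie above
        \<open>(i, j)\<close>.\<close>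
      case 3
      then show ?thesis
        by (auto simp: in_lex_prod intro: exI[of _ "Suc j"])
    qed (auto simp: in_lex_prod)
  qed simp
next
  let ?r = "less_than <*lex*> less_than"
  assume lim: "\<forall>n. (Suc n, 0) \<in> U \<longrightarrow> (\<exists>k. \<forall>m\<ge>k. (n, m) \<in> U)"
  have below: "openin omega_squared {x. (x, a) \<in> ?r}" and above: "openin omega_squared {x. (a, x) \<in> ?r}" for a
    unfolding omega_squared_def order_topology_of_def by (auto intro!: topology_generated_by_Basis)
  show "openin omega_squared U"
  proof (subst openin_subopen, clarify)
    fix i j assume ij: "(i, j) \<in> U"
    \<comment> \<open>Zero, a limit or a successor: each has an open ray or interval around it
      inside \<open>U\<close>.\<close>
    consider "i = 0" "j = 0" | n where "i = Suc n" "j = 0" | m where "j = Suc m"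
      by (metis not0_implies_Suc)
    then show "\<exists>T. openin omega_squared T \<and> (i, j) \<in> T \<and> T \<subseteq> U"
    proof cases
      case 1
      then show ?thesis
        using ij by (intro exI[of _ "{x. (x, (0, 1)) \<in> ?r}"] conjI below) (auto simp: in_lex_prod)
    next
      case 2
      then obtain k where k: "\<forall>m\<ge>k. (n, m) \<in> U"
        using lim ij by blast
      have "p = n \<and> k \<le> q \<or> p = Suc n \<and> q = 0" if "((n, k), (p, q)) \<in> ?r" "((p, q), (Suc n, 1)) \<in> ?r" for p q
        using that by (auto simp: in_lex_prod)
      then have "{x. ((n, k), x) \<in> ?r} \<inter> {x. (x, (Suc n, 1)) \<in> ?r} \<subseteq> U"
        using k ij 2 by force
      then show ?thesis
        using 2 by (intro exI[of _ "{x. ((n, k), x) \<in> ?r} \<inter> {x. (x, (Suc n, 1)) \<in> ?r}"]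
            conjI openin_Int below above) (auto simp: in_lex_prod)
    next
      case 3
      then show ?thesis
        using ij by (intro exI[of _ "{x. ((i, m), x) \<in> ?r} \<inter> {x. (x, (i, Suc (Suc m))) \<in> ?r}"]
            conjI openin_Int below above) (auto simp: in_lex_prod less_Suc_eq)
    qed
  qed
qed

lemma topspace_omega_squared: "topspace omega_squared = UNIV"
  using openin_subset[of omega_squared UNIV] by (auto simp: openin_omega_squared)

lemma maximal_subgroups_omega_squared:
  "has_two_to_continuum_maximal_subgroups (homeo_group omega_squared)"
proof -
  \<comment> \<open>Piece \<open>n\<close> runs from omega n, excluded, to omega (n + 1), included:
    a convergent sequence with its limit. Truncated subtraction, \<open>0 - 1 = 0\<close>, puts the
    ordinal 0 into piece 0.\<close>
  define c :: "nat \<times> nat \<Rightarrow> nat" where "c = (\<lambda>(m, k). if k = 0 then m - 1 else m)"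
  have fibre: "{x \<in> topspace omega_squared. c x = n} =
      (if n = 0 then {(0, 0)} else {}) \<union> {n} \<times> {0<..} \<union> {(Suc n, 0)}" for n
    by (auto simp: c_def topspace_omega_squared split: if_splits)
  have "homeo_equiv omega_squared {x \<in> topspace omega_squared. c x = 0}
      {x \<in> topspace omega_squared. c x = n}" (is "homeo_equiv _ (?F 0) (?F n)") for n
  proof (cases "n = 0")
    case False
    \<comment> \<open>\<open>Suc k\<close>, because piece 0 starts at \<open>(0, 0)\<close> whereas
      \<open>(n, 0)\<close> is the end of the previous piece. The only point of piece 0 outside
      column 0 is its limit \<open>(1, 0)\<close>.\<close>
    define f :: "nat \<times> nat \<Rightarrow> nat \<times> nat" where "f = (\<lambda>(m, k). if m = 0 then (n, Suc k) else (Suc n, 0))"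
    have F0: "?F 0 = insert (1, 0) (range (Pair 0))"
      unfolding fibre by (auto simp: gr0_conv_Suc image_iff)
    have Fn: "?F n = insert (Suc n, 0) (range (\<lambda>k. (n, Suc k)))"
      unfolding fibre using False by (auto simp: gr0_conv_Suc image_iff)
    have "inj_on f (?F 0)"
      unfolding F0 by (auto simp: inj_on_def f_def)
    moreover have "f ` ?F 0 = ?F n"
      unfolding F0 Fn by (simp add: image_image f_def)
    moreover have "openin omega_squared (f ` W) \<longleftrightarrow> openin omega_squared W" if W: "W \<subseteq> ?F 0" for W
    proof -
      have mem: "(n, Suc k) \<in> f ` W \<longleftrightarrow> (0, k) \<in> W" "(Suc n, 0) \<in> f ` W \<longleftrightarrow> (1, 0) \<in> W" for k
        using W F0 by (force simp: f_def)+
      \<comment> \<open>Each piece has a single limit point, so openness of \<open>W\<close> and of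
        its image amounts to one condition each, and the two conditions differ by a shift of the
        bound.\<close>
      have lim: "j = n" if "(Suc j, 0) \<in> f ` W" for j
        using that by (auto simp: f_def split: if_splits)
      have lim': "j = 0" if "(Suc j, 0) \<in> W" for j
        using that W F0 by force
      have "(\<exists>k. \<forall>m\<ge>k. (n, m) \<in> f ` W) \<longleftrightarrow> (\<exists>k. \<forall>m\<ge>k. (0, m) \<in> W)"
      proof
        assume "\<exists>k. \<forall>m\<ge>k. (n, m) \<in> f ` W"
        then obtain k where "\<forall>m\<ge>k. (n, m) \<in> f ` W" ..
        then have "\<forall>m\<ge>k. (0, m) \<in> W"
          using mem(1) by (meson le_Suc_eq)
        then show "\<exists>k. \<forall>m\<ge>k. (0, m) \<in> W" ..
      next
        assume "\<exists>k. \<forall>m\<ge>k. (0, m) \<in> W"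
        then obtain k where k: "\<forall>m\<ge>k. (0, m) \<in> W" ..
        have "(n, m) \<in> f ` W" if "m \<ge> Suc k" for m
          using that k mem(1)[of "m - 1"] by (cases m) auto
        then show "\<exists>k. \<forall>m\<ge>k. (n, m) \<in> f ` W" by blast
      qed
      moreover have "openin omega_squared (f ` W) \<longleftrightarrow> ((Suc n, 0) \<in> f ` W \<longrightarrow> (\<exists>k. \<forall>m\<ge>k. (n, m) \<in> f ` W))"
        unfolding openin_omega_squared using lim by metis
      moreover have "openin omega_squared W \<longleftrightarrow> ((1, 0) \<in> W \<longrightarrow> (\<exists>k. \<forall>m\<ge>k. (0, m) \<in> W))"
        unfolding openin_omega_squared using lim' by (metis One_nat_def)
      ultimately show ?thesis
        using mem(2) by simp
    qed
    ultimately have "homeo_between omega_squared f (?F 0) (?F n)"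
      unfolding homeo_between_def bij_betw_def by blast
    then show ?thesis
      unfolding homeo_equiv_def by blast
  qed (simp add: homeo_equiv_refl)
  moreover have "openin omega_squared {x \<in> topspace omega_squared. c x = n}" for n
    unfolding openin_omega_squared fibre by (auto intro!: exI[of _ 1])
  moreover have "\<exists>x\<in>topspace omega_squared. c x = n" for n
    by (intro bexI[of _ "(n, 1)"]) (auto simp: c_def topspace_omega_squared)
  ultimately interpret infinitely_self_similar omega_squared c
    by unfold_locales
  show ?thesis
    by (intro has_two_to_continuum_maximal_subgroups_homeo_group
        carrier_homeo_group_lepoll_countable) simp
qed

section \<open>The Sorgenfrey line\<close>

lemma topspace_sorgenfrey_line: "topspace sorgenfrey_line = UNIV"
proof -
  have "openin sorgenfrey_line UNIV"
    unfolding openin_sorgenfrey_line by (meson UNIV_I atLeastLessThan_iff less_add_one order_refl subset_UNIV)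
  then show ?thesis
    using openin_subset by blast
qed

lemma openin_sorgenfrey_line_atLeastLessThan: "openin sorgenfrey_line {a..<b}"
  unfolding openin_sorgenfrey_line by blast

lemma openin_sorgenfrey_line_shift:
  assumes "openin sorgenfrey_line U"
  shows "openin sorgenfrey_line ((+) k ` U)"
  unfolding openin_sorgenfrey_line
proof
  fix x assume "x \<in> (+) k ` U"
  then obtain y where y: "y \<in> U" "x = k + y"
    by blast
  then obtain a b where ab: "y \<in> {a..<b}" "{a..<b} \<subseteq> U"
    using assms unfolding openin_sorgenfrey_line by blast
  have "(+) k ` {a..<b} \<subseteq> (+) k ` U"
    using ab(2) by (rule image_mono)
  then have "x \<in> {k + a..<k + b} \<and> {k + a..<k + b} \<subseteq> (+) k ` U"
    using y ab(1) by (simp add: image_add_atLeastLessThan add.commute)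
  then show "\<exists>a b. x \<in> {a..<b} \<and> {a..<b} \<subseteq> (+) k ` U"
    by blast
qed

lemma maximal_subgroups_sorgenfrey_line:
  "has_two_to_continuum_maximal_subgroups (homeo_group sorgenfrey_line)"
proof -
  \<comment> \<open>Half-open intervals are open in this topology, so the integers can serve as cuts
    and the pieces are the integer translates of [0, 1).\<close>
  define c :: "real \<Rightarrow> nat" where "c x = int_encode \<lfloor>x\<rfloor>" for x
  have fibre: "{x \<in> topspace sorgenfrey_line. c x = n} =
      {of_int (int_decode n)..<of_int (int_decode n) + 1}" (is "?F n = ?R n") for n
  proof -
    have eq: "c x = n \<longleftrightarrow> \<lfloor>x\<rfloor> = int_decode n" for x
      unfolding c_def by (metis int_decode_inverse int_encode_inverse)
    show ?thesis
      by (simp add: Set.set_eq_iff eq floor_eq_iff topspace_sorgenfrey_line)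
  qed
  interpret infinitely_self_similar sorgenfrey_line c
  proof
    fix n
    show "openin sorgenfrey_line (?F n)"
      unfolding fibre by (rule openin_sorgenfrey_line_atLeastLessThan)
    show "\<exists>x\<in>topspace sorgenfrey_line. c x = n"
      by (intro bexI[of _ "of_int (int_decode n)"]) (simp_all add: c_def topspace_sorgenfrey_line)
    define k where "k = (of_int (int_decode n) :: real)"
    have "openin sorgenfrey_line ((+) k ` W) \<longleftrightarrow> openin sorgenfrey_line W" for W
      using openin_sorgenfrey_line_shift[of W k] openin_sorgenfrey_line_shift[of "(+) k ` W" "- k"]
      by (auto simp: image_image)
    moreover have "(+) k ` ?F 0 = ?F n"
      unfolding fibre by (simp add: k_def int_decode_def sum_decode_def add.commute)
    ultimately have "homeo_between sorgenfrey_line ((+) k) (?F 0) (?F n)"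
      unfolding homeo_between_def bij_betw_def by simp
    then show "homeo_equiv sorgenfrey_line (?F 0) (?F n)"
      unfolding homeo_equiv_def by blast
  qed
  have "sorgenfrey_line closure_of \<rat> = UNIV"
  proof -
    have "\<exists>y. y \<in> \<rat> \<and> y \<in> T" if T: "x \<in> T \<and> openin sorgenfrey_line T" for x T
    proof -
      obtain a b where ab: "x \<in> {a..<b}" "{a..<b} \<subseteq> T"
        using T unfolding openin_sorgenfrey_line by blast
      \<comment> \<open>The rational is taken strictly to the right of \<open>x\<close>, since a
        neighbourhood of \<open>x\<close> need not extend to its left.\<close>
      then obtain y where "y \<in> \<rat>" "x < y" "y < b"
        using Rats_dense_in_real[of x b] by auto
      then show ?thesis
        using ab by (intro exI[of _ y]) auto
    qed
    then show ?thesis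
      unfolding Set.set_eq_iff in_closure_of topspace_sorgenfrey_line by blast
  qed
  then have "separable_space sorgenfrey_line"
    unfolding separable_space_def
    by (intro exI[of _ \<rat>]) (simp add: countable_rat topspace_sorgenfrey_line)
  moreover have "Hausdorff_space sorgenfrey_line"
    unfolding Hausdorff_space_def
  proof (intro allI impI)
    have *: "\<exists>U V. openin sorgenfrey_line U \<and> openin sorgenfrey_line V \<and> x \<in> U \<and> y \<in> V \<and> disjnt U V"
      if "x < y" for x y
      using that by (intro exI[of _ "{x..<y}"] exI[of _ "{y..<y + 1}"])
        (auto simp: openin_sorgenfrey_line_atLeastLessThan disjnt_def)
    fix x y assume "x \<in> topspace sorgenfrey_line \<and> y \<in> topspace sorgenfrey_line \<and> x \<noteq> y"
    then show "\<exists>U V. openin sorgenfrey_line U \<and> openin sorgenfrey_line V \<and> x \<in> U \<and> y \<in> V \<and> disjnt U V"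
      using *[of x y] *[of y x] disjnt_sym by (metis linorder_neqE)
  qed
  moreover have "topspace sorgenfrey_line \<lesssim> (UNIV :: nat set set)"
    unfolding topspace_sorgenfrey_line using nat_sets_eqpoll_reals eqpoll_imp_lepoll eqpoll_sym by blast
  ultimately show ?thesis
    by (intro has_two_to_continuum_maximal_subgroups_homeo_group carrier_homeo_group_lepoll_separable)
qed

theorem corollary2p10:
  shows "(BijGroup (UNIV :: nat set) = homeo_group (discrete_topology UNIV)
        \<and> has_two_to_continuum_maximal_subgroups (BijGroup (UNIV :: nat set)))
    \<and> has_two_to_continuum_maximal_subgroups (homeo_group (top_of_set (\<rat> :: real set)))
    \<and> has_two_to_continuum_maximal_subgroups (homeo_group baire_space)
    \<and> has_two_to_continuum_maximal_subgroups
         (homeo_group (prod_topology (discrete_topology (UNIV :: nat set)) cantor_space))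
    \<and> has_two_to_continuum_maximal_subgroups (homeo_group omega_squared)
    \<and> has_two_to_continuum_maximal_subgroups (homeo_group sorgenfrey_line)"
  using maximal_subgroups_discrete homeo_group_discrete[where 'a = nat] maximal_subgroups_rationals
    maximal_subgroups_baire maximal_subgroups_nat_times_cantor maximal_subgroups_omega_squared
    maximal_subgroups_sorgenfrey_line by simp

end
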